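(* Let $\mathbb{K}$ be an algebraically closed field of characteristic $0$, let $q,r\in\mathbb{K}$ with $q\neq 0$, and let $p(x)\in\mathbb{K}[x]$. Let $A[q,r;p(x)]$ be the Ore extension of $\mathbb{K}[x]$ generated by $x,y$ subject to the relation $yx = qxy + ry + p(x)$. If one of the following conditions holds: (a) $q=1$, $r=0$ (with no restriction on $p(x)$); (b) $q=1$, $r\neq 0$ and $p(x)=c$ for some $c\in\mathbb{K}$; (c) $q\neq 1$ and $p(x) = c\left(x+\frac{r}{q-1}\right)$ for some $c\in\mathbb{K}$ (with no restriction on $r$); then $A[q,r;p(x)]$ is differentially smooth.
   Context: All algebras are associative and unital over $\mathbb{K}$; "affine" means finitely generated as a $\mathbb{K}$-algebra. Ore extension. For an algebra $A$ with automorphism $\sigma$, a $\sigma$-derivation is a linear map $\delta:A\to A$ with $\delta(aa')=\delta(a)a'+\sigma(a)\delta(a')$; the Ore extension $A[y;\sigma,\delta]$ is obtained by adjoining a generator $y$ with $ya=\sigma(a)y+\delta(a)$ for all $a\in A$. The algebra $A[q,r;p(x)]$ is $\mathbb{K}[x][y;\sigma_{q,r},\delta_p]$, where $\sigma_{q,r}(x)=qx+r$ and $\delta_p(f(x)) = \frac{f(\sigma_{q,r}(x))-f(x)}{\sigma_{q,r}(x)-x}\,p(x)$ (understood as the limit $f'(x)p(x)$ when $q=1,r=0$). Differential calculus. Let $A$ be an algebra. An $n$-dimensional differential calculus over $A$ is a differential graded algebra $(\Omega A, d)$ such that (a) $\Omega A = \bigoplus_{k=0}^n \Omega^k A$ with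 $\Omega^0 A = A$ and $\Omega^n A\neq 0$; (b) as an algebra, $\Omega A$ is generated by $A$ and $d(A)$; (c) $\ker (d|_A) = \mathbb{K}\cdot 1$. The product of elements of positive degree is written $\wedge$. Volume form. The calculus admits a volume form $\omega\in\Omega^n A$ if $\Omega^n A$ is freely generated by $\omega$ as a right $A$-module; associated to a volume form are the algebra automorphism $\nu_\omega: A\to A$ with $a\omega = \omega\nu_\omega(a)$ for all $a \in A$ (so the map $\nu_\omega$ determined by this equation is an automorphism), and the right $A$-module isomorphism $\pi_\omega:\Omega^n A\to A$, $\pi_\omega(\omega a) = a$. Integrating form. Let $\mathcal{I}_k A$ be the space of right $A$-module maps $\Omega^k A\to A$. For $\varphi\in \mathcal{I}_{k+m}A$ and $\omega'\in\Omega^k A$ define $\varphi\cdot\omega'\in\mathcal{I}_m A$ by $(\varphi\cdot\omega')(\omega'') = \varphi(\omega'\wedge\omega'')$ for $\omega''\in\Omega^m A$. A volume form $\omega\in\Omega^n A$ is an integrating form if for every $k=1,\ldots,n-1$ the map $\Omega^k A\to\mathcal{I}_{n-k}A$, $\omega'\mapsto\pi_\omega\cdot\omega'$, is bijective. A calculus admitting an integrating form is called integrable. Differential smoothness. An affine algebra of Gelfand-Kirillov dimension $n$ is differentially smooth if it admits an $n$-dimensional integrable differential calculus. *)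

theory Defs
  imports
    Complex_Main
    "HOL-Library.Function_Algebras"
    "HOL-Library.FuncSet"
    "HOL-Library.Extended_Real"
    "HOL-Library.Liminf_Limsup"
    "HOL-Computational_Algebra.Polynomial"
begin

section \<open>Algebras over a field\<close>

text \<open>
  Algebras are associative and unital, not necessarily commutative.  The addition of an algebra is
  that of the ambient type, its other operations are data, and its carrier is a linear subspace
  of the type.  Nothing is assumed about products outside the carrier.
\<close>

record ('k, 'a) kalg =
  alg_carrier :: "'a set"
  alg_scale :: "'k \<Rightarrow> 'a \<Rightarrow> 'a"
  alg_mult :: "'a \<Rightarrow> 'a \<Rightarrow> 'a"  (infixl "\<otimes>\<index>" 70)
  alg_one :: "'a"  ("\<one>\<index>")

locale kalgebra = vector_space "alg_scale A"
  for A :: "('k::field, 'a::ab_group_add, 'm) kalg_scheme" (structure) +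
  assumes subspace_carrier: "subspace (alg_carrier A)"
    and one_closed: "\<one> \<in> alg_carrier A"
    and mult_closed: "\<lbrakk>a \<in> alg_carrier A; b \<in> alg_carrier A\<rbrakk> \<Longrightarrow> a \<otimes> b \<in> alg_carrier A"
    and mult_assoc:
      "\<lbrakk>a \<in> alg_carrier A; b \<in> alg_carrier A; c \<in> alg_carrier A\<rbrakk>
        \<Longrightarrow> (a \<otimes> b) \<otimes> c = a \<otimes> (b \<otimes> c)"
    and one_left: "a \<in> alg_carrier A \<Longrightarrow> \<one> \<otimes> a = a"
    and one_right: "a \<in> alg_carrier A \<Longrightarrow> a \<otimes> \<one> = a"
    and distrib_left:
      "\<lbrakk>a \<in> alg_carrier A; b \<in> alg_carrier A; c \<in> alg_carrier A\<rbrakk>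
        \<Longrightarrow> a \<otimes> (b + c) = a \<otimes> b + a \<otimes> c"
    and distrib_right:
      "\<lbrakk>a \<in> alg_carrier A; b \<in> alg_carrier A; c \<in> alg_carrier A\<rbrakk>
        \<Longrightarrow> (a + b) \<otimes> c = a \<otimes> c + b \<otimes> c"
    and scale_mult_left:
      "\<lbrakk>a \<in> alg_carrier A; b \<in> alg_carrier A\<rbrakk>
        \<Longrightarrow> alg_scale A t a \<otimes> b = alg_scale A t (a \<otimes> b)"
    and scale_mult_right:
      "\<lbrakk>a \<in> alg_carrier A; b \<in> alg_carrier A\<rbrakk>
        \<Longrightarrow> a \<otimes> alg_scale A t b = alg_scale A t (a \<otimes> b)"

definition subalgebra :: "('k::field, 'a::ab_group_add, 'm) kalg_scheme \<Rightarrow> 'a set \<Rightarrow> bool" where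
  "subalgebra A B \<longleftrightarrow>
     B \<subseteq> alg_carrier A \<and> module.subspace (alg_scale A) B \<and> \<one>\<^bsub>A\<^esub> \<in> B \<and>
     (\<forall>a\<in>B. \<forall>b\<in>B. a \<otimes>\<^bsub>A\<^esub> b \<in> B)"

definition generates :: "('k::field, 'a::ab_group_add, 'm) kalg_scheme \<Rightarrow> 'a set \<Rightarrow> bool" where
  "generates A S \<longleftrightarrow> S \<subseteq> alg_carrier A \<and> subalgebra A hull S = alg_carrier A"

definition affine_algebra :: "('k::field, 'a::ab_group_add, 'm) kalg_scheme \<Rightarrow> bool" where
  "affine_algebra A \<longleftrightarrow> (\<exists>S. finite S \<and> generates A S)"

definition alg_hom ::
  "('k::field, 'a::ab_group_add, 'm) kalg_scheme \<Rightarrow> ('k, 'b::ab_group_add, 'l) kalg_scheme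
    \<Rightarrow> ('a \<Rightarrow> 'b) \<Rightarrow> bool" where
  "alg_hom A B f \<longleftrightarrow>
     (\<forall>a\<in>alg_carrier A. f a \<in> alg_carrier B) \<and>
     (\<forall>a\<in>alg_carrier A. \<forall>b\<in>alg_carrier A. f (a + b) = f a + f b) \<and>
     (\<forall>t. \<forall>a\<in>alg_carrier A. f (alg_scale A t a) = alg_scale B t (f a)) \<and>
     (\<forall>a\<in>alg_carrier A. \<forall>b\<in>alg_carrier A. f (a \<otimes>\<^bsub>A\<^esub> b) = f a \<otimes>\<^bsub>B\<^esub> f b) \<and>
     f \<one>\<^bsub>A\<^esub> = \<one>\<^bsub>B\<^esub>"

definition alg_automorphism ::
  "('k::field, 'a::ab_group_add, 'm) kalg_scheme \<Rightarrow> ('a \<Rightarrow> 'a) \<Rightarrow> bool" where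
  "alg_automorphism A f \<longleftrightarrow> alg_hom A A f \<and> bij_betw f (alg_carrier A) (alg_carrier A)"


section \<open>Gelfand-Kirillov dimension\<close>

text \<open>\<open>power_sum A V m\<close> is the subspace $\sum_{i=0}^{m} V^i$, where $V^0 = \mathbb{K} \cdot 1$.\<close>

definition power_sum ::
  "('k::field, 'a::ab_group_add, 'm) kalg_scheme \<Rightarrow> 'a set \<Rightarrow> nat \<Rightarrow> 'a set" where
  "power_sum A V m =
     module.span (alg_scale A)
       {foldr (alg_mult A) vs \<one>\<^bsub>A\<^esub> |vs. set vs \<subseteq> V \<and> length vs \<le> m}"

text \<open>
  $\mathrm{GKdim}(A) = \sup_V \limsup_m \log_m \dim \sum_{i\le m} V^i$, with $V$ ranging over the
  finite-dimensional subspaces of $A$.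
\<close>

definition gk_dim :: "('k::field, 'a::ab_group_add, 'm) kalg_scheme \<Rightarrow> ereal" where
  "gk_dim A =
     (SUP V \<in> {module.span (alg_scale A) S |S. finite S \<and> S \<subseteq> alg_carrier A}.
        limsup (\<lambda>m. ereal (log (real m)
          (real (vector_space.dim (alg_scale A) (power_sum A V m))))))"


section \<open>Differential calculi\<close>

record ('k, 'w) dga = "('k, 'w) kalg" +
  grade :: "nat \<Rightarrow> 'w set"
  diff :: "'w \<Rightarrow> 'w"

locale diff_graded_algebra = kalgebra \<Omega>
  for \<Omega> :: "('k::field, 'w::ab_group_add, 'm) dga_scheme" (structure) +
  assumes subspace_grade: "subspace (grade \<Omega> k)"
    and grade_carrier: "grade \<Omega> k \<subseteq> alg_carrier \<Omega>"
    and direct_sum: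
      "w \<in> alg_carrier \<Omega> \<Longrightarrow>
        \<exists>!f. (\<forall>k. f k \<in> grade \<Omega> k) \<and> finite {k. f k \<noteq> 0} \<and> w = (\<Sum>k | f k \<noteq> 0. f k)"
    and one_grade: "\<one> \<in> grade \<Omega> 0"
    and mult_grade:
      "\<lbrakk>v \<in> grade \<Omega> k; w \<in> grade \<Omega> l\<rbrakk> \<Longrightarrow> v \<otimes> w \<in> grade \<Omega> (k + l)"
    and diff_add:
      "\<lbrakk>v \<in> alg_carrier \<Omega>; w \<in> alg_carrier \<Omega>\<rbrakk>
        \<Longrightarrow> diff \<Omega> (v + w) = diff \<Omega> v + diff \<Omega> w"
    and diff_scale:
      "w \<in> alg_carrier \<Omega> \<Longrightarrow> diff \<Omega> (alg_scale \<Omega> t w) = alg_scale \<Omega> t (diff \<Omega> w)"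
    and diff_grade: "w \<in> grade \<Omega> k \<Longrightarrow> diff \<Omega> w \<in> grade \<Omega> (Suc k)"
    and diff_diff: "w \<in> alg_carrier \<Omega> \<Longrightarrow> diff \<Omega> (diff \<Omega> w) = 0"
    and leibniz:
      "\<lbrakk>v \<in> grade \<Omega> k; w \<in> alg_carrier \<Omega>\<rbrakk>
        \<Longrightarrow> diff \<Omega> (v \<otimes> w) = diff \<Omega> v \<otimes> w + alg_scale \<Omega> ((-1) ^ k) (v \<otimes> diff \<Omega> w)"

text \<open>
  The identification of \<open>A\<close> with the degree zero part is an explicit algebra isomorphism \<open>\<iota>\<close>, as
  \<open>A\<close> and the calculus live in different types.
\<close>

locale differential_calculus = A: kalgebra A + diff_graded_algebra \<Omega>
  for n :: nat
    and A :: "('k::field, 'a::ab_group_add, 'm) kalg_scheme"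
    and \<Omega> :: "('k, 'w::ab_group_add, 'l) dga_scheme"
    and \<iota> :: "'a \<Rightarrow> 'w" +
  assumes hom_iota: "alg_hom A \<Omega> \<iota>"
    and bij_iota: "bij_betw \<iota> (alg_carrier A) (grade \<Omega> 0)"
    and grade_above: "k > n \<Longrightarrow> grade \<Omega> k = {0}"
    and grade_top: "grade \<Omega> n \<noteq> {0}"
    and generated: "generates \<Omega> (\<iota> ` alg_carrier A \<union> (diff \<Omega> \<circ> \<iota>) ` alg_carrier A)"
    and kernel_diff:
      "{a \<in> alg_carrier A. diff \<Omega> (\<iota> a) = 0} = range (\<lambda>t. alg_scale A t \<one>\<^bsub>A\<^esub>)"

definition free_generator ::
  "nat \<Rightarrow> ('k::field, 'a::ab_group_add, 'm) kalg_scheme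
    \<Rightarrow> ('k, 'w::ab_group_add, 'l) dga_scheme \<Rightarrow> ('a \<Rightarrow> 'w) \<Rightarrow> 'w \<Rightarrow> bool" where
  "free_generator n A \<Omega> \<iota> \<omega> \<longleftrightarrow>
     \<omega> \<in> grade \<Omega> n \<and> bij_betw (\<lambda>a. \<omega> \<otimes>\<^bsub>\<Omega>\<^esub> \<iota> a) (alg_carrier A) (grade \<Omega> n)"

text \<open>The map $\pi_\omega$ with $\pi_\omega(\omega a) = a$.\<close>

definition volume_coord ::
  "('k::field, 'a::ab_group_add, 'm) kalg_scheme
    \<Rightarrow> ('k, 'w::ab_group_add, 'l) dga_scheme \<Rightarrow> ('a \<Rightarrow> 'w) \<Rightarrow> 'w \<Rightarrow> 'w \<Rightarrow> 'a" where
  "volume_coord A \<Omega> \<iota> \<omega> \<eta> = (THE a. a \<in> alg_carrier A \<and> \<eta> = \<omega> \<otimes>\<^bsub>\<Omega>\<^esub> \<iota> a)"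

text \<open>The map $\nu_\omega$ with $a \omega = \omega \nu_\omega(a)$.\<close>

definition volume_twist ::
  "('k::field, 'a::ab_group_add, 'm) kalg_scheme
    \<Rightarrow> ('k, 'w::ab_group_add, 'l) dga_scheme \<Rightarrow> ('a \<Rightarrow> 'w) \<Rightarrow> 'w \<Rightarrow> 'a \<Rightarrow> 'a" where
  "volume_twist A \<Omega> \<iota> \<omega> a = (THE b. b \<in> alg_carrier A \<and> \<iota> a \<otimes>\<^bsub>\<Omega>\<^esub> \<omega> = \<omega> \<otimes>\<^bsub>\<Omega>\<^esub> \<iota> b)"

definition volume_form ::
  "nat \<Rightarrow> ('k::field, 'a::ab_group_add, 'm) kalg_scheme
    \<Rightarrow> ('k, 'w::ab_group_add, 'l) dga_scheme \<Rightarrow> ('a \<Rightarrow> 'w) \<Rightarrow> 'w \<Rightarrow> bool" where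
  "volume_form n A \<Omega> \<iota> \<omega> \<longleftrightarrow>
     free_generator n A \<Omega> \<iota> \<omega> \<and> alg_automorphism A (volume_twist A \<Omega> \<iota> \<omega>)"

text \<open>
  The right \<open>A\<close>-module maps $\Omega^m A \to A$, set to \<open>undefined\<close> off $\Omega^m A$ so that equality of
  functions is equality on $\Omega^m A$.
\<close>

definition integral_maps ::
  "('k::field, 'a::ab_group_add, 'm) kalg_scheme
    \<Rightarrow> ('k, 'w::ab_group_add, 'l) dga_scheme \<Rightarrow> ('a \<Rightarrow> 'w) \<Rightarrow> nat \<Rightarrow> ('w \<Rightarrow> 'a) set" where
  "integral_maps A \<Omega> \<iota> m =
     {\<phi> \<in> grade \<Omega> m \<rightarrow>\<^sub>E alg_carrier A.
        (\<forall>v\<in>grade \<Omega> m. \<forall>w\<in>grade \<Omega> m. \<phi> (v + w) = \<phi> v + \<phi> w) \<and>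
        (\<forall>v\<in>grade \<Omega> m. \<forall>a\<in>alg_carrier A. \<phi> (v \<otimes>\<^bsub>\<Omega>\<^esub> \<iota> a) = \<phi> v \<otimes>\<^bsub>A\<^esub> a)}"

text \<open>The right action $\mathcal{I}_{k+m} A \times \Omega^k A \to \mathcal{I}_m A$.\<close>

definition integral_act ::
  "('k::field, 'w::ab_group_add, 'l) dga_scheme \<Rightarrow> nat \<Rightarrow> ('w \<Rightarrow> 'a) \<Rightarrow> 'w \<Rightarrow> 'w \<Rightarrow> 'a" where
  "integral_act \<Omega> m \<phi> v = restrict (\<lambda>w. \<phi> (v \<otimes>\<^bsub>\<Omega>\<^esub> w)) (grade \<Omega> m)"

definition integrating_form ::
  "nat \<Rightarrow> ('k::field, 'a::ab_group_add, 'm) kalg_scheme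
    \<Rightarrow> ('k, 'w::ab_group_add, 'l) dga_scheme \<Rightarrow> ('a \<Rightarrow> 'w) \<Rightarrow> 'w \<Rightarrow> bool" where
  "integrating_form n A \<Omega> \<iota> \<omega> \<longleftrightarrow>
     volume_form n A \<Omega> \<iota> \<omega> \<and>
     (\<forall>k\<in>{1..<n}.
        bij_betw (integral_act \<Omega> (n - k) (volume_coord A \<Omega> \<iota> \<omega>))
          (grade \<Omega> k) (integral_maps A \<Omega> \<iota> (n - k)))"

definition integrable_calculus ::
  "nat \<Rightarrow> ('k::field, 'a::ab_group_add, 'm) kalg_scheme
    \<Rightarrow> ('k, 'w::ab_group_add, 'l) dga_scheme \<Rightarrow> ('a \<Rightarrow> 'w) \<Rightarrow> bool" where
  "integrable_calculus n A \<Omega> \<iota> \<longleftrightarrow>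
     differential_calculus n A \<Omega> \<iota> \<and> (\<exists>\<omega>. integrating_form n A \<Omega> \<iota> \<omega>)"

text \<open>
  HOL cannot quantify over the type carrying a calculus, so the calculus is sought on a subspace
  of \<open>nat \<Rightarrow> 'a\<close>, with an arbitrary scalar multiplication.  This loses no calculus up to
  isomorphism: being generated by $A$ and $d(A)$, a calculus has dimension at most
  $\max(\dim A, \aleph_0)$, hence embeds linearly into the space of sequences in a nonzero \<open>A\<close>.
\<close>

definition differentially_smooth ::
  "('k::field, 'a::ab_group_add, 'm) kalg_scheme \<Rightarrow> bool" where
  "differentially_smooth A \<longleftrightarrow>
     kalgebra A \<and> affine_algebra A \<and>
     (\<exists>n. gk_dim A = ereal (real n) \<and>
        (\<exists>(\<Omega> :: ('k, nat \<Rightarrow> 'a) dga) \<iota>. integrable_calculus n A \<Omega> \<iota>))"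


section \<open>The Ore extensions\<close>

text \<open>
  $R[y;\sigma,\delta]$ for commutative $R$ is realised on \<open>R poly\<close>: the polynomial with
  coefficients $a_i$ stands for $\sum_i a_i y^i$, coefficients on the left.  Left multiplication
  by $y$ is then $\sum_i a_i y^i \mapsto \sum_i (\sigma(a_i) y^{i+1} + \delta(a_i) y^i)$.
\<close>

definition ore_y ::
  "('r \<Rightarrow> 'r) \<Rightarrow> ('r \<Rightarrow> 'r) \<Rightarrow> 'r::comm_ring_1 poly \<Rightarrow> 'r poly" where
  "ore_y \<sigma> \<delta> g = pCons 0 (map_poly \<sigma> g) + map_poly \<delta> g"

definition ore_mult ::
  "('r \<Rightarrow> 'r) \<Rightarrow> ('r \<Rightarrow> 'r) \<Rightarrow> 'r::comm_ring_1 poly \<Rightarrow> 'r poly \<Rightarrow> 'r poly" where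
  "ore_mult \<sigma> \<delta> f g = (\<Sum>i\<le>degree f. smult (coeff f i) ((ore_y \<sigma> \<delta> ^^ i) g))"

definition sigma_qr :: "'k::field \<Rightarrow> 'k \<Rightarrow> 'k poly \<Rightarrow> 'k poly" where
  "sigma_qr q r f = pcompose f [:r, q:]"

text \<open>
  The divisor $\sigma_{q,r}(x) - x = (q-1)x + r$ divides the dividend, so \<open>div\<close> is the exact quotient.
\<close>

definition delta_p :: "'k::field \<Rightarrow> 'k \<Rightarrow> 'k poly \<Rightarrow> 'k poly \<Rightarrow> 'k poly" where
  "delta_p q r p f =
     (if q = 1 \<and> r = 0 then pderiv f * p
      else ((sigma_qr q r f - f) div (sigma_qr q r [:0, 1:] - [:0, 1:])) * p)"

definition ore_qrp :: "'k::field \<Rightarrow> 'k \<Rightarrow> 'k poly \<Rightarrow> ('k, 'k poly poly) kalg" where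
  "ore_qrp q r p =
     \<lparr>alg_carrier = UNIV,
      alg_scale = (\<lambda>t. smult [:t:]),
      alg_mult = ore_mult (sigma_qr q r) (delta_p q r p),
      alg_one = 1\<rparr>"

abbreviation (input) ore_gen_x :: "'k::field poly poly" where
  "ore_gen_x \<equiv> [:[:0, 1:]:]"

abbreviation (input) ore_gen_y :: "'k::field poly poly" where
  "ore_gen_y \<equiv> [:0, 1:]"

lemma delta_p_0: "delta_p q r p 0 = 0"
  by (simp add: delta_p_def sigma_qr_def)

lemma delta_p_1: "delta_p q r p 1 = 0"
  by (simp add: delta_p_def sigma_qr_def pderiv_1 pcompose_1)

lemma delta_p_x: "delta_p q r p [:0, 1:] = p"
proof (cases "q = 1 \<and> r = 0")
  case False
  then have "sigma_qr q r [:0, 1:] - [:0, 1:] \<noteq> 0"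
    by (auto simp: sigma_qr_def pcompose_pCons)
  with False show ?thesis
    by (auto simp: delta_p_def)
qed (simp add: delta_p_def pderiv_pCons)

lemma delta_p_twisted_leibniz:
  "delta_p q r p (f * g) = delta_p q r p f * g + sigma_qr q r f * delta_p q r p g"
proof (cases "q = 1 \<and> r = 0")
  case True
  then show ?thesis
    by (simp add: delta_p_def sigma_qr_def pderiv_mult algebra_simps)
next
  case False
  define D where "D = sigma_qr q r [:0, 1:] - [:0, 1:]"
  have "D \<noteq> 0"
    using False by (auto simp: D_def sigma_qr_def pcompose_pCons)
  have dvd: "D dvd sigma_qr q r h - h" for h
  proof (induction h)
    case 0
    then show ?case by (simp add: sigma_qr_def)
  next
    case (pCons a h)
    have "sigma_qr q r (pCons a h) - pCons a h =
        [:r, q:] * (sigma_qr q r h - h) + D * h"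
      by (simp add: sigma_qr_def D_def pcompose_pCons algebra_simps smult_diff_left)
    then show ?case
      using pCons.IH by (metis dvd_add dvd_mult dvd_triv_left)
  qed
  obtain u v where u: "sigma_qr q r f - f = D * u" and v: "sigma_qr q r g - g = D * v"
    using dvd by (meson dvdE)
  have "sigma_qr q r (f * g) - f * g
      = (sigma_qr q r f - f) * g + sigma_qr q r f * (sigma_qr q r g - g)"
    by (simp add: sigma_qr_def pcompose_mult algebra_simps)
  also have "\<dots> = D * (u * g + sigma_qr q r f * v)"
    by (simp add: u v algebra_simps)
  finally show ?thesis
    using False u v \<open>D \<noteq> 0\<close> by (auto simp: delta_p_def algebra_simps simp flip: D_def)
qed

lemma ore_mult_y_const:
  assumes "\<sigma> 0 = 0" "\<delta> 0 = 0"
  shows "ore_mult \<sigma> \<delta> ore_gen_y [:a:] = ore_mult \<sigma> \<delta> [:\<sigma> a:] ore_gen_y + [:\<delta> a:]"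
  using assms by (simp add: ore_mult_def ore_y_def map_poly_pCons)

lemma ore_qrp_relation:
  fixes q r :: "'k::field" and p :: "'k poly"
  defines "A \<equiv> ore_qrp q r p"
  shows "ore_gen_y \<otimes>\<^bsub>A\<^esub> ore_gen_x =
    alg_scale A q (ore_gen_x \<otimes>\<^bsub>A\<^esub> ore_gen_y) + alg_scale A r ore_gen_y + [:p:]"
proof -
  have "sigma_qr q r 0 = 0"
    by (simp add: sigma_qr_def)
  from ore_mult_y_const[of "sigma_qr q r" "delta_p q r p" "[:0, 1:]", OF this delta_p_0]
  show ?thesis
    by (simp add: A_def ore_qrp_def delta_p_x sigma_qr_def ore_mult_def pcompose_pCons)
qed

end

theory Submission
  imports Defs
begin

text \<open>
  Why the algebras are differentially smooth.  Consider an algebra \<open>A\<close> with bijections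
  \<open>N1\<close>, \<open>N2\<close>, linear maps \<open>D1\<close>, \<open>D2\<close> that satisfy \<open>D (a b) = D a b + N a D b\<close>, and
  coordinates \<open>x1\<close>, \<open>x2\<close> with \<open>Di xj = 1\<close> or \<open>0\<close> according to whether \<open>i = j\<close>.  One-forms
  \<open>dx1 b + dx2 c\<close> then form a free right module of rank two on which \<open>A\<close> acts from the left by
  \<open>a dxi = dxi Ni a\<close>, and \<open>da = dx1 D1 a + dx2 D2 a\<close> is a derivation.  Imposing
  \<open>dx1 dx1 = dx2 dx2 = 0\<close> and \<open>dx2 dx1 = - s dx1 dx2\<close> extends this to a two-dimensional
  differential graded algebra as soon as \<open>D2 D1 = s D1 D2\<close>: this one relation, evaluated at
  products \<open>a xj\<close>, forces all the commutation rules between the \<open>Ni\<close> and the \<open>Dj\<close>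
  (lemmas \<open>D2_N1\<close>, \<open>N2_D1\<close>, \<open>N1_N2\<close>) that associativity and the Leibniz rule require.  The
  volume form \<open>dx1 dx2\<close> is integrating because the product of the one-forms
  \<open>dx1 b + dx2 c\<close> and \<open>dx1 b' + dx2 c'\<close> is \<open>dx1 dx2 (N2 b c' - s N1 c b')\<close>, a perfect
  pairing when \<open>N1\<close>, \<open>N2\<close> are bijective and \<open>s\<close> is invertible.  If the joint kernel of
  \<open>D1\<close>, \<open>D2\<close> consists of scalars, this is an integrable calculus
  (\<open>skew_partials.integrable_calculus\<close>).

  On \<open>A[q,r;p]\<close>, write \<open>\<sigma>\<close> and \<open>\<delta>\<close> for the twisting data on \<open>K[x]\<close> and take
  \<open>D\<^sub>x (\<Sum> f\<^sub>i y^i) = \<Sum> f\<^sub>i' y^i\<close> and \<open>D\<^sub>y (\<Sum> f\<^sub>i y^i) = \<Sum> i \<sigma>^(-1)(f\<^sub>i) y^(i - 1)\<close>, with \<open>s = q\<close>.  These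
  are twisted derivations whenever \<open>\<delta>\<close> commutes with \<open>\<sigma>^(-1)\<close> and
  \<open>(\<delta> f)' = q \<delta> (f') + p' f'\<close> (\<open>map_poly_derivation\<close>, \<open>pderiv_twisted\<close>).  The three cases of the
  theorem share one reason for these identities: either \<open>\<sigma>\<close> is the identity and
  \<open>\<delta> f = f' p\<close>, or \<open>p\<close> is a scalar multiple \<open>\<kappa> (\<sigma> x - x)\<close>, and then \<open>\<delta> = \<kappa> (\<sigma> - id)\<close>
  (\<open>delta_p_inner\<close>).

  The Gelfand-Kirillov dimension is two: giving \<open>x\<close> weight \<open>1\<close> and \<open>y\<close> weight \<open>deg p + 1\<close>
  filters the algebra, so powers of a finite-dimensional space stay inside spaces of
  polynomials of linearly growing degree, while the powers of the span of \<open>x\<close>, \<open>y\<close> contain all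
  monomials \<open>x^i y^j\<close>.
\<close>

section \<open>The calculus of two twisted partial derivatives\<close>

lemma subalgebra_hullI:
  "(\<And>B. \<lbrakk>subalgebra K B; S \<subseteq> B\<rbrakk> \<Longrightarrow> w \<in> B) \<Longrightarrow> w \<in> subalgebra K hull S"
  by (auto simp: hull_def)

text \<open>
  The twist \<open>N\<close> is a bare bijection here: that it is an algebra automorphism follows from the
  twisted Leibniz rule and the existence of a coordinate \<open>z\<close>.
\<close>

locale skew_derivation = kalgebra A
  for A :: "('k::field, 'a::ab_group_add, 'm) kalg_scheme" (structure) +
  fixes D N :: "'a \<Rightarrow> 'a" and z :: 'a
  assumes full: "alg_carrier A = UNIV"
    and D_add: "D (a + b) = D a + D b"
    and D_scale: "D (alg_scale A t a) = alg_scale A t (D a)"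
    and D_mult: "D (a \<otimes> b) = D a \<otimes> b + N a \<otimes> D b"
    and D_coordinate: "D z = \<one>"
    and bij_N: "bij N"
begin

lemmas assoc = mult_assoc[unfolded full, OF UNIV_I UNIV_I UNIV_I]
  and one_l = one_left[unfolded full, OF UNIV_I]
  and one_r = one_right[unfolded full, OF UNIV_I]
  and add_r = distrib_left[unfolded full, OF UNIV_I UNIV_I UNIV_I]
  and add_l = distrib_right[unfolded full, OF UNIV_I UNIV_I UNIV_I]
  and scale_l = scale_mult_left[unfolded full, OF UNIV_I UNIV_I]
  and scale_r = scale_mult_right[unfolded full, OF UNIV_I UNIV_I]

lemma zero_l: "0 \<otimes> a = 0" and zero_r: "a \<otimes> 0 = 0"
  using add_l[of 0 0 a] add_r[of a 0 0] by simp_all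

lemma minus_l: "(- a) \<otimes> b = - (a \<otimes> b)" and minus_r: "a \<otimes> (- b) = - (a \<otimes> b)"
  using add_l[of a "- a" b] add_r[of a b "- b"] by (simp_all add: zero_l zero_r eq_neg_iff_add_eq_0 add.commute)

lemma diff_l: "(a - b) \<otimes> c = a \<otimes> c - b \<otimes> c" and diff_r: "c \<otimes> (a - b) = c \<otimes> a - c \<otimes> b"
  using add_l[of a "- b" c] add_r[of c a "- b"] by (simp_all add: minus_l minus_r)

lemma D_zero: "D 0 = 0"
  using D_add[of 0 0] by simp

lemma D_minus: "D (- a) = - D a"
  using D_add[of a "- a"] by (simp add: D_zero eq_neg_iff_add_eq_0 add.commute)

lemma N_eq: "N a = D (a \<otimes> z) - D a \<otimes> z"
  by (simp add: D_mult D_coordinate one_r)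

lemma N_add: "N (a + b) = N a + N b"
  by (simp only: N_eq add_l D_add) simp

lemma N_scale: "N (alg_scale A t a) = alg_scale A t (N a)"
  by (simp only: N_eq scale_l D_scale) (simp add: scale_right_diff_distrib)

text \<open>
  By associativity, \<open>D (a b z)\<close> can be expanded as \<open>D ((a b) z)\<close> and as \<open>D (a (b z))\<close>; comparing
  the two gives the multiplicativity of the twist.
\<close>

lemma N_mult: "N (a \<otimes> b) = N a \<otimes> N b"
  by (simp only: N_eq[of "a \<otimes> b"] assoc D_mult[of a "b \<otimes> z"])
    (simp add: N_eq[of b] D_mult[of a b] add_l assoc diff_r)

lemma N_zero: "N 0 = 0"
  using N_add[of 0 0] by simp

lemma N_minus: "N (- a) = - N a"
  using N_add[of a "- a"] by (simp add: N_zero eq_neg_iff_add_eq_0 add.commute)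

text \<open>
  By surjectivity \<open>1 = N u\<close> for some \<open>u\<close>, and multiplication by \<open>N 1\<close> fixes every \<open>N u\<close>.
\<close>

lemma N_one: "N \<one> = \<one>"
proof -
  obtain u where "\<one> = N u"
    using bij_N by (metis bij_pointE)
  then show ?thesis
    by (metis N_mult one_l one_r)
qed

lemma D_one: "D \<one> = 0"
  using D_mult[of \<one> \<one>] by (simp add: N_one one_l one_r)

end

text \<open>
  Two twisted partial derivatives with dual coordinates that commute up to the factor \<open>s\<close>.
\<close>

locale skew_partials =
  P: skew_derivation A D1 N1 x1 + Q: skew_derivation A D2 N2 x2
  for A :: "('k::field, 'a::ab_group_add, 'm) kalg_scheme" (structure)
    and D1 N1 :: "'a \<Rightarrow> 'a" and x1 :: 'a
    and D2 N2 :: "'a \<Rightarrow> 'a" and x2 :: 'a +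
  fixes s :: 'k
  assumes nontrivial: "\<one> \<noteq> 0"
    and s_nonzero: "s \<noteq> 0"
    and D1_x2: "D1 x2 = 0"
    and D2_x1: "D2 x1 = 0"
    and D2_D1: "D2 (D1 a) = alg_scale A s (D1 (D2 a))"
    and joint_kernel: "\<lbrakk>D1 a = 0; D2 a = 0\<rbrakk> \<Longrightarrow> a \<in> range (\<lambda>t. alg_scale A t \<one>)"
begin

text \<open>
  Both twisted derivatives of \<open>a x1\<close> in either order are computed by the Leibniz rule.  As
  \<open>D1 x1 = 1\<close> and \<open>D2 x1 = 0\<close>, the terms that survive next to \<open>D2 (D1 a) x1\<close> are those stated.
  Replacing \<open>x1\<close> by \<open>x2\<close> gives the companion rule \<open>N2_D1\<close>.
\<close>

lemma D2_N1: "D2 (N1 a) = alg_scale A s (N1 (D2 a))"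
  using D2_D1[of "a \<otimes> x1"]
  by (simp add: P.D_mult Q.D_mult P.D_add Q.D_add P.D_coordinate D2_x1 P.D_zero Q.D_one
      P.one_r P.zero_r D2_D1 P.scale_l P.scale_right_distrib)

lemma N2_D1: "N2 (D1 a) = alg_scale A s (D1 (N2 a))"
  using D2_D1[of "a \<otimes> x2"]
  by (simp add: P.D_mult Q.D_mult P.D_add Q.D_add Q.D_coordinate D1_x2 Q.D_zero P.D_one
      P.one_r P.zero_r D2_D1 P.scale_l P.scale_right_distrib)

text \<open>
  Once \<open>D2_N1\<close> and \<open>N2_D1\<close> are known, the relation \<open>D2 D1 = s D1 D2\<close> at a product \<open>a b\<close> reduces to
  \<open>N2 (N1 a) (D2 (D1 b)) = N1 (N2 a) (s D1 (D2 b))\<close>.  For \<open>b = x1 x2\<close> both second factors are \<open>1\<close>.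
\<close>

lemma N1_N2: "N1 (N2 a) = N2 (N1 a)"
proof -
  define b where "b = x1 \<otimes> x2"
  have D1b: "D1 b = x2" and "D2 (D1 b) = \<one>"
    by (simp_all add: b_def P.D_mult P.D_coordinate D1_x2 P.one_l P.zero_r Q.D_coordinate)
  then have D12b: "alg_scale A s (D1 (D2 b)) = \<one>"
    by (metis D2_D1)
  have "D2 (D1 (a \<otimes> b)) = D2 (D1 a) \<otimes> b + N2 (D1 a) \<otimes> D2 b
      + (D2 (N1 a) \<otimes> D1 b + N2 (N1 a) \<otimes> D2 (D1 b))"
    by (simp add: P.D_mult Q.D_mult Q.D_add)
  moreover have "D1 (D2 (a \<otimes> b)) = D1 (D2 a) \<otimes> b + N1 (D2 a) \<otimes> D1 b
      + (D1 (N2 a) \<otimes> D2 b + N1 (N2 a) \<otimes> D1 (D2 b))"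
    by (simp add: P.D_mult Q.D_mult P.D_add)
  ultimately have "N2 (N1 a) \<otimes> D2 (D1 b) = N1 (N2 a) \<otimes> alg_scale A s (D1 (D2 b))"
    using D2_D1[of "a \<otimes> b"]
    by (auto simp: D2_N1 N2_D1 D2_D1 P.scale_right_distrib P.scale_l P.scale_r algebra_simps)
  then show ?thesis
    by (simp add: D12b D2_D1 P.one_r)
qed

text \<open>
  \<open>form a b c e\<close> stands for \<open>a + dx1 b + dx2 c + dx1 dx2 e\<close>, with the coefficients on the right.
  The four coefficients occupy the first four entries of a sequence.
\<close>

definition form :: "'a \<Rightarrow> 'a \<Rightarrow> 'a \<Rightarrow> 'a \<Rightarrow> nat \<Rightarrow> 'a" where
  "form a b c e = (\<lambda>_. 0)(0 := a, 1 := b, 2 := c, 3 := e)"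

text \<open>
  The product is forced by \<open>a dxi = dxi Ni a\<close>, \<open>dxi dxi = 0\<close> and \<open>dx2 dx1 = - s dx1 dx2\<close>.
\<close>

definition wedge :: "(nat \<Rightarrow> 'a) \<Rightarrow> (nat \<Rightarrow> 'a) \<Rightarrow> nat \<Rightarrow> 'a" where
  "wedge v w = form
     (v 0 \<otimes> w 0)
     (v 1 \<otimes> w 0 + N1 (v 0) \<otimes> w 1)
     (v 2 \<otimes> w 0 + N2 (v 0) \<otimes> w 2)
     (v 3 \<otimes> w 0 + N2 (N1 (v 0)) \<otimes> w 3
       + (N2 (v 1) \<otimes> w 2 - alg_scale A s (N1 (v 2) \<otimes> w 1)))"

text \<open>
  \<open>d (dx1 b) = - dx1 db = - dx1 dx2 D2 b\<close>, and \<open>d (dx2 c) = - dx2 dc = - dx2 dx1 D1 c\<close>, which is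
  \<open>dx1 dx2 (s D1 c)\<close>.
\<close>

definition exterior :: "(nat \<Rightarrow> 'a) \<Rightarrow> nat \<Rightarrow> 'a" where
  "exterior w = form 0 (D1 (w 0)) (D2 (w 0)) (alg_scale A s (D1 (w 2)) - D2 (w 1))"

definition calculus :: "('k, nat \<Rightarrow> 'a) dga" where
  "calculus =
     \<lparr>alg_carrier = {w. \<forall>i>3. w i = 0},
      alg_scale = (\<lambda>t w i. alg_scale A t (w i)),
      alg_mult = wedge,
      alg_one = form \<one> 0 0 0,
      grade = (\<lambda>k. {w. (\<forall>i>3. w i = 0) \<and> (k \<noteq> 0 \<longrightarrow> w 0 = 0) \<and>
        (k \<noteq> 1 \<longrightarrow> w 1 = 0 \<and> w 2 = 0) \<and> (k \<noteq> 2 \<longrightarrow> w 3 = 0)}),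
      diff = exterior\<rparr>"

abbreviation embed :: "'a \<Rightarrow> nat \<Rightarrow> 'a" where
  "embed a \<equiv> form a 0 0 0"

lemma form_simps [simp]:
  "form a b c e 0 = a" "form a b c e (Suc 0) = b" "form a b c e 2 = c" "form a b c e 3 = e"
  "i > 3 \<Longrightarrow> form a b c e i = 0"
  by (simp_all add: form_def)

lemma nat_cases_upto_3: "i = 0 \<or> i = Suc 0 \<or> i = 2 \<or> i = 3 \<or> i > (3::nat)"
  by linarith

lemma form_eqI:
  assumes "\<And>i. i > 3 \<Longrightarrow> v i = 0" "\<And>i. i > 3 \<Longrightarrow> w i = (0::'a)"
    and "v 0 = w 0" "v (Suc 0) = w (Suc 0)" "v 2 = w 2" "v 3 = w 3"
  shows "v = w"
proof
  fix i show "v i = w i" using nat_cases_upto_3[of i] assms by auto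
qed

lemma form_eq_iff: "form a b c e = form a' b' c' e' \<longleftrightarrow> a = a' \<and> b = b' \<and> c = c' \<and> e = e'"
  by (metis form_simps(1-4))

lemma form_eta: "\<forall>i>3. w i = 0 \<Longrightarrow> w = form (w 0) (w (Suc 0)) (w 2) (w 3)"
  by (rule form_eqI) auto

lemma form_cases: "\<forall>i>3. w i = 0 \<Longrightarrow> \<exists>a b c e. w = form a b c e"
  using form_eta by blast

lemma form_zero: "form 0 0 0 0 = 0"
  by (rule form_eqI) auto

lemma form_add: "form a b c e + form a' b' c' e' = form (a + a') (b + b') (c + c') (e + e')"
  by (rule form_eqI) auto

lemma wedge_form: "wedge (form a b c e) (form a' b' c' e') =
    form (a \<otimes> a') (b \<otimes> a' + N1 a \<otimes> b') (c \<otimes> a' + N2 a \<otimes> c')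
      (e \<otimes> a' + N2 (N1 a) \<otimes> e' + (N2 b \<otimes> c' - alg_scale A s (N1 c \<otimes> b')))"
  by (simp add: wedge_def)

lemma exterior_form:
  "exterior (form a b c e) = form 0 (D1 a) (D2 a) (alg_scale A s (D1 c) - D2 b)"
  by (simp add: exterior_def)

lemmas linear_simps =
  P.zero_l P.zero_r P.one_l P.one_r P.add_l P.add_r P.scale_l P.scale_r P.minus_l P.minus_r
  P.diff_l P.diff_r P.assoc
  P.scale_right_distrib P.scale_right_diff_distrib P.scale_minus_right P.scale_zero_right
  P.D_add P.D_scale P.D_zero P.D_minus P.D_one
  Q.D_add Q.D_scale Q.D_zero Q.D_minus Q.D_one
  P.N_add P.N_scale P.N_zero P.N_minus P.N_one P.N_mult
  Q.N_add Q.N_scale Q.N_zero Q.N_minus Q.N_one Q.N_mult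

lemma vector_space_calculus: "vector_space (alg_scale calculus)"
  by unfold_locales (auto simp: calculus_def fun_eq_iff P.scale_right_distrib P.scale_left_distrib)

lemma subspace_calculus_iff:
  "module.subspace (alg_scale calculus) S \<longleftrightarrow>
     0 \<in> S \<and> (\<forall>v\<in>S. \<forall>w\<in>S. v + w \<in> S) \<and> (\<forall>t. \<forall>w\<in>S. alg_scale calculus t w \<in> S)"
  by (simp add: module.subspace_def module_iff_vector_space vector_space_calculus)

lemma kalgebra_calculus: "kalgebra calculus"
proof (intro kalgebra.intro vector_space_calculus kalgebra_axioms.intro)
  show "module.subspace (alg_scale calculus) (alg_carrier calculus)"
    unfolding subspace_calculus_iff by (auto simp: calculus_def)
qed (auto simp: calculus_def wedge_def form_add form_eq_iff linear_simps algebra_simps N1_N2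
    intro!: form_eqI)

lemma calculus_sel [simp]:
  "alg_carrier calculus = {w. \<forall>i>3. w i = 0}"
  "alg_scale calculus = (\<lambda>t w i. alg_scale A t (w i))"
  "alg_mult calculus = wedge" "alg_one calculus = embed \<one>" "diff calculus = exterior"
  by (simp_all add: calculus_def)

lemma scale_form: "(\<lambda>i. alg_scale A t (form a b c e i)) =
    form (alg_scale A t a) (alg_scale A t b) (alg_scale A t c) (alg_scale A t e)"
  by (rule form_eqI) auto

lemma minus_form: "(\<lambda>i. - form a b c e i) = form (- a) (- b) (- c) (- e)"
  by (rule form_eqI) auto

lemma mem_grade_iff: "w \<in> grade calculus k \<longleftrightarrow> (\<forall>i>3. w i = 0) \<and> (k \<noteq> 0 \<longrightarrow> w 0 = 0) \<and>
    (k \<noteq> 1 \<longrightarrow> w 1 = 0 \<and> w 2 = 0) \<and> (k \<noteq> 2 \<longrightarrow> w 3 = 0)"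
  by (simp add: calculus_def)

lemma grade_0: "grade calculus 0 = range embed"
  by (auto simp: mem_grade_iff intro!: form_eqI)

lemma grade_1: "grade calculus (Suc 0) = {form 0 b c 0 |b c. True}"
  by (fastforce simp: mem_grade_iff intro!: form_eqI)

lemma grade_2: "grade calculus 2 = range (form 0 0 0)"
  by (auto simp: mem_grade_iff intro!: form_eqI)

lemma grade_3: "k > 2 \<Longrightarrow> grade calculus k = {0}"
  by (auto simp: mem_grade_iff fun_eq_iff) (metis nat_cases_upto_3 One_nat_def)

lemma degree_cases: "k = 0 \<or> k = Suc 0 \<or> k = 2 \<or> k > (2::nat)"
  by linarith

lemma calculus_decomposition:
  assumes "w \<in> alg_carrier calculus"
  shows "\<exists>!f. (\<forall>k. f k \<in> grade calculus k) \<and> finite {k. f k \<noteq> 0} \<and> w = (\<Sum>k | f k \<noteq> 0. f k)"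
proof -
  have sum_eq: "(\<Sum>k | f k \<noteq> 0. f k) = form (f 0 0) (f 1 1) (f 1 2) (f 2 3)"
    if f: "\<forall>k. f k \<in> grade calculus k" for f :: "nat \<Rightarrow> nat \<Rightarrow> 'a"
  proof -
    have "f k = 0" if "k > 2" for k
      using f grade_3[OF that] by auto
    then have "{k. f k \<noteq> 0} \<subseteq> {0, 1, 2}"
      by (smt (verit) degree_cases insertCI mem_Collect_eq One_nat_def subsetI)
    then have "(\<Sum>k | f k \<noteq> 0. f k) = (\<Sum>k\<in>{0, 1, 2}. f k)"
      by (intro sum.mono_neutral_left) auto
    also have "\<dots> = form (f 0 0) (f 1 1) (f 1 2) (f 2 3)"
      using f[rule_format, of 0] f[rule_format, of 1] f[rule_format, of 2]
      by (intro form_eqI) (auto simp: mem_grade_iff)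
    finally show ?thesis .
  qed
  define f where "f = (\<lambda>k::nat. if k = 0 then embed (w 0) else if k = 1 then form 0 (w 1) (w 2) 0
    else if k = 2 then form 0 0 0 (w 3) else 0)"
  have f_grade: "\<forall>k. f k \<in> grade calculus k"
    by (auto simp: f_def mem_grade_iff)
  have "{k. f k \<noteq> 0} \<subseteq> {..2}"
    by (auto simp: f_def split: if_splits)
  then have f_fin: "finite {k. f k \<noteq> 0}"
    using finite_subset by blast
  have f_sum: "w = (\<Sum>k | f k \<noteq> 0. f k)"
    unfolding sum_eq[OF f_grade] using assms form_eta[of w] by (simp add: f_def)
  show ?thesis
  proof (intro ex1I[of _ f] conjI f_grade f_fin f_sum)
    fix g assume "(\<forall>k. g k \<in> grade calculus k) \<and> finite {k. g k \<noteq> 0} \<and> w = (\<Sum>k | g k \<noteq> 0. g k)"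
    then have g: "\<forall>k. g k \<in> grade calculus k" and "w = form (g 0 0) (g 1 1) (g 1 2) (g 2 3)"
      using sum_eq[of g] by auto
    then have w: "w 0 = g 0 0" "w 1 = g 1 1" "w 2 = g 1 2" "w 3 = g 2 3"
      by simp_all
    show "g = f"
    proof
      fix k
      have "g k \<in> grade calculus k"
        using g by blast
      then show "g k = f k"
        using degree_cases[of k] w grade_3[of k]
        by (auto simp: f_def mem_grade_iff intro!: form_eqI)
    qed
  qed
qed

lemma diff_graded_calculus: "diff_graded_algebra calculus"
proof (intro diff_graded_algebra.intro kalgebra_calculus diff_graded_algebra_axioms.intro)
  fix k
  show "module.subspace (alg_scale calculus) (grade calculus k)"
    unfolding subspace_calculus_iff by (auto simp: mem_grade_iff)
  show "grade calculus k \<subseteq> alg_carrier calculus"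
    by (auto simp: mem_grade_iff)
next
  fix w assume "w \<in> alg_carrier calculus"
  then show "\<exists>!f. (\<forall>k. f k \<in> grade calculus k) \<and> finite {k. f k \<noteq> 0} \<and> w = (\<Sum>k | f k \<noteq> 0. f k)"
    by (rule calculus_decomposition)
next
  fix v w k l assume "v \<in> grade calculus k" "w \<in> grade calculus l"
  with degree_cases[of k] degree_cases[of l]
  show "v \<otimes>\<^bsub>calculus\<^esub> w \<in> grade calculus (k + l)"
    by (elim disjE) (simp_all add: mem_grade_iff wedge_def linear_simps)
next
  fix v w k assume v: "v \<in> grade calculus k" and w: "w \<in> alg_carrier calculus"
  obtain a b c e where [simp]: "w = form a b c e"
    using form_cases[of w] w by auto
  from degree_cases[of k]
  show "diff calculus (v \<otimes>\<^bsub>calculus\<^esub> w) = diff calculus v \<otimes>\<^bsub>calculus\<^esub> w +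
      alg_scale calculus ((-1) ^ k) (v \<otimes>\<^bsub>calculus\<^esub> diff calculus w)"
  proof (elim disjE)
    assume [simp]: "k = 0"
    obtain u where [simp]: "v = embed u"
      using v by (auto simp: grade_0)
    show ?thesis
      by (simp add: wedge_form exterior_form form_add form_eq_iff scale_form linear_simps
          P.D_mult Q.D_mult D2_N1 N2_D1 N1_N2 algebra_simps)
  next
    assume [simp]: "k = Suc 0"
    obtain u1 u2 where [simp]: "v = form 0 u1 u2 0"
      using v by (auto simp: grade_1)
    show ?thesis
      by (simp add: wedge_form exterior_form form_add form_eq_iff scale_form minus_form linear_simps
          P.D_mult Q.D_mult D2_N1 N2_D1 algebra_simps)
  next
    assume [simp]: "k = 2"
    obtain u where [simp]: "v = form 0 0 0 u"
      using v by (auto simp: grade_2)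
    show ?thesis
      by (simp add: wedge_form exterior_form form_add form_eq_iff scale_form linear_simps)
  next
    assume "k > 2"
    with v have "v = embed 0"
      by (simp add: grade_3 form_zero)
    then show ?thesis
      by (simp add: wedge_form exterior_form form_add form_eq_iff scale_form linear_simps)
  qed
next
  fix w k assume "w \<in> grade calculus k"
  then show "diff calculus w \<in> grade calculus (Suc k)"
    by (auto simp: mem_grade_iff exterior_def linear_simps)
qed (auto simp: exterior_def mem_grade_iff form_add form_eq_iff scale_form linear_simps D2_D1
    form_zero intro!: form_eqI)

lemma embed_hom: "alg_hom A calculus embed"
  by (simp add: alg_hom_def P.full form_add scale_form wedge_form linear_simps)

lemma calculus_generated:
  "generates calculus (embed ` alg_carrier A \<union> (diff calculus \<circ> embed) ` alg_carrier A)"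
    (is "generates _ ?S")
proof -
  have S: "?S \<subseteq> alg_carrier calculus"
    by (auto simp: exterior_def)
  have "subalgebra calculus (alg_carrier calculus)"
    using kalgebra.subspace_carrier[OF kalgebra_calculus] kalgebra.one_closed[OF kalgebra_calculus]
      kalgebra.mult_closed[OF kalgebra_calculus]
    unfolding subalgebra_def by blast
  then have "subalgebra calculus hull ?S \<subseteq> alg_carrier calculus"
    using S by (rule hull_minimal[rotated])
  moreover have "alg_carrier calculus \<subseteq> subalgebra calculus hull ?S"
  proof (intro subsetI subalgebra_hullI)
    fix w B assume w: "w \<in> alg_carrier calculus" and B: "subalgebra calculus B" "?S \<subseteq> B"
    have mult: "wedge u v \<in> B" if "u \<in> B" "v \<in> B" for u v
      using B that by (simp add: subalgebra_def)
    have add: "u + v \<in> B" if "u \<in> B" "v \<in> B" for u v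
      using B that unfolding subalgebra_def subspace_calculus_iff by blast
    have embed: "embed a \<in> B" for a
      using B(2) by (auto simp: P.full)
    have "exterior (embed a) \<in> B" for a
      using B(2) by (auto simp: P.full)
    \<comment> \<open>The differentials of the two coordinates are the basis one-forms.\<close>
    from this[of x1] this[of x2] have dx: "form 0 \<one> 0 0 \<in> B" "form 0 0 \<one> 0 \<in> B"
      by (simp_all add: exterior_form linear_simps P.D_coordinate Q.D_coordinate D1_x2 D2_x1)
    obtain a b c e where "w = form a b c e"
      using w form_cases[of w] by auto
    also have "\<dots> = embed a + (wedge (form 0 \<one> 0 0) (embed b) + (wedge (form 0 0 \<one> 0) (embed c)
        + wedge (wedge (form 0 \<one> 0 0) (form 0 0 \<one> 0)) (embed e)))"
      by (simp add: wedge_form form_add linear_simps)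
    also have "\<dots> \<in> B"
      by (intro add mult embed dx)
    finally show "w \<in> B" .
  qed
  ultimately show ?thesis
    using S unfolding generates_def by blast
qed

lemma differential_calculus: "differential_calculus 2 A calculus embed"
proof (intro differential_calculus.intro P.kalgebra_axioms diff_graded_calculus
    differential_calculus_axioms.intro embed_hom calculus_generated)
  show "bij_betw embed (alg_carrier A) (grade calculus 0)"
    by (auto simp: bij_betw_def inj_on_def form_eq_iff P.full grade_0)
  show "grade calculus k = {0}" if "k > 2" for k
    using that by (rule grade_3)
  show "grade calculus 2 \<noteq> {0}"
  proof
    assume "grade calculus 2 = {0}"
    then have "form 0 0 0 \<one> = 0"
      by (auto simp: grade_2)
    then have "\<one> = 0"
      by (metis form_simps(4) zero_fun_apply)
    then show False
      using nontrivial by contradiction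
  qed
  show "{a \<in> alg_carrier A. diff calculus (embed a) = 0} = range (\<lambda>t. alg_scale A t \<one>)"
    using joint_kernel by (auto simp: P.full exterior_form form_eq_iff linear_simps simp flip: form_zero)
qed

lemma volume_coord: "volume_coord A calculus embed (form 0 0 0 \<one>) (form 0 0 0 a) = a"
  by (auto simp: volume_coord_def P.full wedge_form linear_simps form_eq_iff)

text \<open>
  Moving \<open>a\<close> past \<open>dx1 dx2\<close> twists it first by \<open>N1\<close> and then by \<open>N2\<close>.
\<close>

lemma volume_twist: "volume_twist A calculus embed (form 0 0 0 \<one>) = N2 \<circ> N1"
  by (auto simp: volume_twist_def P.full wedge_form linear_simps form_eq_iff)

lemma volume_form: "volume_form 2 A calculus embed (form 0 0 0 \<one>)"
proof -
  have "bij (N2 \<circ> N1)"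
    using P.bij_N Q.bij_N by (rule bij_comp)
  then show ?thesis
    by (auto simp: volume_form_def free_generator_def alg_automorphism_def alg_hom_def volume_twist
        P.full grade_2 wedge_form linear_simps bij_betw_def inj_on_def form_eq_iff)
qed

text \<open>
  Only one-forms have to be paired with one-forms.  A right linear map on one-forms is given by
  its values on \<open>dx1\<close> and \<open>dx2\<close>, and the pairing with \<open>dx1 b + dx2 c\<close> takes there the values
  \<open>- s N1 c\<close> and \<open>N2 b\<close>.  As \<open>N1\<close>, \<open>N2\<close> are bijective and \<open>s\<close> is invertible, each pair of values
  comes from exactly one \<open>(b, c)\<close>.
\<close>

lemma integrating_form: "integrating_form 2 A calculus embed (form 0 0 0 \<one>)"
  unfolding integrating_form_def
proof (intro conjI volume_form ballI)
  fix k :: nat assume "k \<in> {1..<2}"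
  then have [simp]: "k = Suc 0" "2 - k = Suc 0"
    by auto
  define act where "act = integral_act calculus (Suc 0) (volume_coord A calculus embed (form 0 0 0 \<one>))"
  have act: "act (form 0 b c 0) (form 0 b' c' 0) = N2 b \<otimes> c' - alg_scale A s (N1 c \<otimes> b')" for b c b' c'
    by (auto simp: act_def integral_act_def grade_1 wedge_form volume_coord linear_simps form_eq_iff)
  have act_outside: "act v w = undefined" if "w \<notin> grade calculus (Suc 0)" for v w
    using that by (simp add: act_def integral_act_def)
  have "inj_on act (grade calculus (Suc 0))"
  proof (rule inj_onI)
    fix v w assume "v \<in> grade calculus (Suc 0)" "w \<in> grade calculus (Suc 0)" and eq: "act v = act w"
    then obtain b c b' c' where v: "v = form 0 b c 0" and w: "w = form 0 b' c' 0"
      by (auto simp: grade_1)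
    have "N2 b = N2 b'"
      using fun_cong[OF eq, of "form 0 0 \<one> 0"] by (simp add: v w act linear_simps)
    moreover have "N1 c = N1 c'"
      using fun_cong[OF eq, of "form 0 \<one> 0 0"] s_nonzero by (simp add: v w act linear_simps)
    ultimately show "v = w"
      using P.bij_N Q.bij_N by (simp add: v w bij_def inj_eq)
  qed
  moreover have "act ` grade calculus (Suc 0) \<subseteq> integral_maps A calculus embed (Suc 0)"
  proof (rule image_subsetI)
    fix v assume "v \<in> grade calculus (Suc 0)"
    then obtain b c where v: "v = form 0 b c 0"
      by (auto simp: grade_1)
    have "act v \<in> extensional (grade calculus (Suc 0))"
      by (simp add: extensional_def act_outside)
    then show "act v \<in> integral_maps A calculus embed (Suc 0)"
      by (auto simp: integral_maps_def PiE_def P.full v grade_1 form_add act wedge_form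
          linear_simps algebra_simps)
  qed
  moreover have "integral_maps A calculus embed (Suc 0) \<subseteq> act ` grade calculus (Suc 0)"
  proof
    fix \<phi> assume \<phi>: "\<phi> \<in> integral_maps A calculus embed (Suc 0)"
    obtain b c where b: "N2 b = \<phi> (form 0 0 \<one> 0)" and
      c: "N1 c = alg_scale A (- inverse s) (\<phi> (form 0 \<one> 0 0))"
      using P.bij_N Q.bij_N by (metis bij_pointE)
    have "\<phi> w = act (form 0 b c 0) w" for w
    proof (cases "w \<in> grade calculus (Suc 0)")
      case False
      then show ?thesis
        using \<phi> by (auto simp: integral_maps_def act_outside PiE_def extensional_def)
    next
      case True
      then obtain b' c' where w: "w = form 0 b' c' 0"
        by (auto simp: grade_1)
      have "w = wedge (form 0 \<one> 0 0) (embed b') + wedge (form 0 0 \<one> 0) (embed c')"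
        by (simp add: w wedge_form form_add linear_simps)
      moreover have "wedge (form 0 \<one> 0 0) (embed b') \<in> grade calculus (Suc 0)"
          "wedge (form 0 0 \<one> 0) (embed c') \<in> grade calculus (Suc 0)"
        by (auto simp: grade_1 wedge_form linear_simps)
      ultimately have "\<phi> w = \<phi> (wedge (form 0 \<one> 0 0) (embed b')) + \<phi> (wedge (form 0 0 \<one> 0) (embed c'))"
        using \<phi> by (simp add: integral_maps_def)
      also have "\<dots> = \<phi> (form 0 \<one> 0 0) \<otimes> b' + \<phi> (form 0 0 \<one> 0) \<otimes> c'"
        using \<phi> by (auto simp: integral_maps_def grade_1 P.full form_eq_iff)
      also have "\<dots> = act (form 0 b c 0) w"
        using s_nonzero by (simp add: w act b c linear_simps)
      finally show ?thesis .
    qed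
    then have "\<phi> = act (form 0 b c 0)"
      by blast
    then show "\<phi> \<in> act ` grade calculus (Suc 0)"
      by (auto simp: grade_1)
  qed
  ultimately show "bij_betw (integral_act calculus (2 - k) (volume_coord A calculus embed (form 0 0 0 \<one>)))
      (grade calculus k) (integral_maps A calculus embed (2 - k))"
    unfolding bij_betw_def act_def[symmetric] by (auto simp flip: act_def)
qed

theorem integrable_calculus: "integrable_calculus 2 A calculus embed"
  unfolding integrable_calculus_def using differential_calculus integrating_form by blast

end

section \<open>Skew polynomial rings\<close>

lemma ore_y_pCons:
  assumes "\<sigma> 0 = 0" "\<delta> 0 = 0"
  shows "ore_y \<sigma> \<delta> (pCons a g) = [:\<delta> a, \<sigma> a:] + pCons 0 (ore_y \<sigma> \<delta> g)"
  using assms by (simp add: ore_y_def map_poly_pCons)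

lemma coeff_ore_y:
  assumes "\<sigma> 0 = 0" "\<delta> 0 = 0"
  shows "coeff (ore_y \<sigma> \<delta> g) n = (if n = 0 then 0 else \<sigma> (coeff g (n - 1))) + \<delta> (coeff g n)"
  using assms by (auto simp: ore_y_def coeff_map_poly coeff_pCons split: nat.split)

lemma ore_mult_eq_sum:
  assumes "degree f \<le> n"
  shows "ore_mult \<sigma> \<delta> f g = (\<Sum>i\<le>n. smult (coeff f i) ((ore_y \<sigma> \<delta> ^^ i) g))"
  unfolding ore_mult_def using assms
  by (intro sum.mono_neutral_left) (auto simp: coeff_eq_0)

lemma ore_mult_0_left [simp]: "ore_mult \<sigma> \<delta> 0 g = 0"
  by (simp add: ore_mult_def)

text \<open>
  This recursion, which splits off the constant coefficient on the left and moves one factor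
  \<open>y\<close> to the right argument, replaces the defining sum in all inductions below.
\<close>

lemma ore_mult_pCons:
  "ore_mult \<sigma> \<delta> (pCons a f) g = smult a g + ore_mult \<sigma> \<delta> f (ore_y \<sigma> \<delta> g)"
proof -
  have "degree (pCons a f) \<le> Suc (degree f)"
    by (rule degree_pCons_le)
  from ore_mult_eq_sum[OF this] show ?thesis
    by (simp add: sum.atMost_Suc_shift ore_mult_def funpow_swap1 del: sum.atMost_Suc)
qed

lemma ore_mult_const: "ore_mult \<sigma> \<delta> [:a:] g = smult a g"
  by (simp add: ore_mult_def)

lemma ore_mult_add_left:
  "ore_mult \<sigma> \<delta> (f + f') g = ore_mult \<sigma> \<delta> f g + ore_mult \<sigma> \<delta> f' g"
  by (induction f f' arbitrary: g rule: poly_induct2)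
    (simp_all add: ore_mult_pCons smult_add_left)

lemma ore_mult_smult_left: "ore_mult \<sigma> \<delta> (smult a f) g = smult a (ore_mult \<sigma> \<delta> f g)"
  by (induction f arbitrary: g) (simp_all add: ore_mult_pCons smult_add_right)

text \<open>
  A left linear map sending the powers \<open>y^i\<close> to elements \<open>b i\<close> of degree at most \<open>i\<close> has a
  triangular matrix; it is bijective if the diagonal entries are units.
\<close>

lemma triangular_bij:
  fixes b :: "nat \<Rightarrow> 'r::idom poly"
  assumes deg: "\<And>i. degree (b i) \<le> i" and unit: "\<And>i. coeff (b i) i dvd 1"
    and T: "\<And>f n. degree f \<le> n \<Longrightarrow> T f = (\<Sum>i\<le>n. smult (coeff f i) (b i))"
  shows "bij T"
proof -
  have add: "T (f + g) = T f + T g" for f g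
    using T[of f "max (degree f) (degree g)"] T[of g "max (degree f) (degree g)"]
      T[of "f + g" "max (degree f) (degree g)"]
    by (simp add: degree_add_le_max smult_add_left sum.distrib)
  have T_diff: "T (f - g) = T f - T g" for f g
    by (metis add add_diff_cancel diff_add_cancel)
  have T_monom: "T (monom a n) = smult a (b n)" for a n
  proof -
    have "T (monom a n) = (\<Sum>i\<le>n. if i = n then smult a (b i) else 0)"
      unfolding T[OF degree_monom_le] by (intro sum.cong) auto
    then show ?thesis
      by simp
  qed
  have T_lead: "coeff (T f) (degree f) = lead_coeff f * coeff (b (degree f)) (degree f)" for f
  proof -
    have "coeff (T f) (degree f) = (\<Sum>i\<le>degree f. coeff f i * coeff (b i) (degree f))"
      by (simp add: T[OF order_refl] coeff_sum)
    also have "\<dots> = (\<Sum>i\<le>degree f. if i = degree f then coeff f i * coeff (b i) (degree f) else 0)"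
      by (intro sum.cong) (auto intro!: coeff_eq_0 le_less_trans[OF deg])
    finally show ?thesis
      by simp
  qed
  have "f = g" if "T f = T g" for f g
  proof -
    have "lead_coeff (f - g) * coeff (b (degree (f - g))) (degree (f - g)) = 0"
      using that T_lead[of "f - g"] by (simp add: T_diff)
    moreover have "coeff (b (degree (f - g))) (degree (f - g)) \<noteq> 0"
      using unit by (metis dvd_0_left zero_neq_one)
    ultimately have "lead_coeff (f - g) = 0"
      by (simp del: coeff_diff)
    then show ?thesis
      by (simp only: leading_coeff_0_iff right_minus_eq)
  qed
  moreover have "\<exists>g. T g = f" if "\<And>i. i \<ge> n \<Longrightarrow> coeff f i = 0" for f n
    using that
  proof (induction n arbitrary: f)
    case 0
    then have "f = 0"
      by (intro poly_eqI) simp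
    then show ?case
      using T_diff[of 0 0] by auto
  next
    case (Suc n)
    obtain c where c: "coeff (b n) n * c = 1"
      using unit[of n] by (auto simp: dvd_def)
    \<comment> \<open>Subtracting a multiple of \<open>b n\<close> clears the top coefficient of \<open>f\<close>.\<close>
    define f' where "f' = f - smult (coeff f n * c) (b n)"
    have "coeff f' i = 0" if "i \<ge> n" for i
    proof (cases "i = n")
      case True
      then show ?thesis
        using c by (simp add: f'_def mult.assoc mult.commute[of c])
    next
      case False
      then show ?thesis
        using that Suc.prems[of i] deg[of n] by (simp add: f'_def coeff_eq_0)
    qed
    from Suc.IH[OF this] obtain g where "T g = f'"
      by blast
    then have "T (g + monom (coeff f n * c) n) = f"
      by (simp add: add T_monom f'_def)
    then show ?case
      by blast
  qed
  then have "\<exists>g. T g = f" for f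
    by (metis coeff_eq_0 less_eq_Suc_le)
  ultimately show ?thesis
    unfolding bij_def inj_def surj_def by metis
qed

locale skew_polynomials =
  fixes \<sigma> \<delta> :: "'r::comm_ring_1 \<Rightarrow> 'r"
  assumes \<sigma>_add: "\<sigma> (a + b) = \<sigma> a + \<sigma> b"
    and \<sigma>_mult: "\<sigma> (a * b) = \<sigma> a * \<sigma> b"
    and \<sigma>_one: "\<sigma> 1 = 1"
    and \<delta>_add: "\<delta> (a + b) = \<delta> a + \<delta> b"
    and \<delta>_mult: "\<delta> (a * b) = \<delta> a * b + \<sigma> a * \<delta> b"
begin

abbreviation "Y \<equiv> ore_y \<sigma> \<delta>"
abbreviation "L \<equiv> ore_mult \<sigma> \<delta>"

lemma \<sigma>_zero [simp]: "\<sigma> 0 = 0" and \<delta>_zero [simp]: "\<delta> 0 = 0"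
  using \<sigma>_add[of 0 0] \<delta>_add[of 0 0] by simp_all

lemma \<delta>_one: "\<delta> 1 = 0"
  using \<delta>_mult[of 1 1] by (simp add: \<sigma>_one)

lemmas coeff_Y = coeff_ore_y[of \<sigma> \<delta>, OF \<sigma>_zero \<delta>_zero]

lemma Y_zero [simp]: "Y 0 = 0"
  by (rule poly_eqI) (simp add: coeff_Y)

lemma Y_add: "Y (f + g) = Y f + Y g"
  by (rule poly_eqI) (simp add: coeff_Y \<sigma>_add \<delta>_add)

lemma Y_smult: "Y (smult a g) = smult (\<sigma> a) (Y g) + smult (\<delta> a) g"
  by (rule poly_eqI) (simp add: coeff_Y \<sigma>_mult \<delta>_mult algebra_simps)

lemma Y_pCons: "Y (pCons a g) = pCons (\<delta> a) ([:\<sigma> a:] + Y g)"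
  by (simp add: ore_y_pCons)

lemma Y_one: "Y 1 = pCons 0 1"
  by (simp add: one_pCons Y_pCons \<sigma>_one \<delta>_one)

lemma L_zero_right [simp]: "L f 0 = 0"
  by (induction f) (simp_all add: ore_mult_pCons)

lemma L_add_right: "L f (g + h) = L f g + L f h"
  by (induction f arbitrary: g h) (simp_all add: ore_mult_pCons Y_add smult_add_right)

lemma L_smult_right:
  assumes "\<sigma> c = c" "\<delta> c = 0"
  shows "L f (smult c g) = smult c (L f g)"
  using assms by (induction f arbitrary: g)
    (simp_all add: ore_mult_pCons Y_smult smult_add_right mult.commute)

text \<open>
  Associativity for a left factor \<open>y\<close>, to which \<open>L_assoc\<close> reduces the general case.
\<close>

lemma L_Y_left: "L (Y g) h = Y (L g h)"
  by (induction g arbitrary: h)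
    (simp_all add: ore_mult_pCons Y_pCons Y_add Y_smult ore_mult_add_left add_ac)

lemma L_assoc: "L (L f g) h = L f (L g h)"
  by (induction f arbitrary: g h)
    (simp_all add: ore_mult_pCons ore_mult_add_left ore_mult_smult_left L_Y_left)

lemma L_pCons_0: "L f (pCons 0 g) = pCons 0 (L f g)"
  by (induction f arbitrary: g) (simp_all add: ore_mult_pCons Y_pCons)

lemma L_one_right: "L f 1 = f"
  by (induction f) (simp_all add: ore_mult_pCons Y_one L_pCons_0)

lemma L_one_left: "L 1 f = f"
  using ore_mult_const[of \<sigma> \<delta> 1 f] by (simp add: one_pCons)

end

lemma pderiv_map_poly:
  fixes h :: "'r::idom \<Rightarrow> 'r"
  assumes add: "\<And>a b. h (a + b) = h a + h b"
  shows "pderiv (map_poly h f) = map_poly h (pderiv f)"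
proof -
  have h0: "h 0 = 0"
    by (metis add add_0 add_cancel_left_right)
  have "h (of_nat n * a) = of_nat n * h a" for n a
    by (induction n) (simp_all add: h0 add distrib_right)
  then show ?thesis
    by (intro poly_eqI) (simp only: coeff_pderiv coeff_map_poly h0)
qed

lemma map_poly_add_hom:
  assumes add: "\<And>a b. h (a + b) = h a + h b"
  shows "map_poly h (f + g :: 'r::comm_ring_1 poly) = map_poly h f + map_poly (h :: 'r \<Rightarrow> 'r) g"
  using add[of 0 0] by (intro poly_eqI) (simp add: coeff_map_poly add)

text \<open>
  Extending a derivation \<open>d\<close> of the coefficient ring by \<open>d y = 0\<close>.  The hypotheses are what the
  relation \<open>y a = \<sigma> a y + \<delta> a\<close> demands when \<open>y\<close> is twisted to \<open>Z = u y + v\<close>: differentiating both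
  sides gives \<open>Z d a = d (\<sigma> a) y + d (\<delta> a)\<close>.  The twist fixes coefficients and sends \<open>y\<close> to
  \<open>Z\<close>.  As left multiplication by \<open>Z\<close> has the shape of a left multiplication by \<open>y\<close> with
  modified twisting data, the operator substituting \<open>Z\<close> for \<open>y\<close> is again an \<open>ore_mult\<close>.
\<close>

lemma (in skew_polynomials) map_poly_derivation:
  fixes d :: "'r \<Rightarrow> 'r" and u v :: 'r
  defines "N \<equiv> ore_mult (\<lambda>a. u * \<sigma> a) (\<lambda>a. u * \<delta> a + v * a)"
  assumes d_add: "\<And>a b. d (a + b) = d a + d b"
    and d_mult: "\<And>a b. d (a * b) = d a * b + a * d b"
    and d_\<sigma>: "\<And>a. d (\<sigma> a) = u * \<sigma> (d a)"
    and d_\<delta>: "\<And>a. d (\<delta> a) = u * \<delta> (d a) + v * d a"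
  shows "map_poly d (L f g) = L (map_poly d f) g + L (N f 1) (map_poly d g)"
proof -
  have d0 [simp]: "d 0 = 0"
    using d_add[of 0 0] by simp
  define Z where "Z = ore_y (\<lambda>a. u * \<sigma> a) (\<lambda>a. u * \<delta> a + v * a)"
  have Z: "Z g = smult u (Y g) + smult v g" for g
    by (rule poly_eqI) (simp add: Z_def coeff_ore_y coeff_Y algebra_simps)
  have N_pCons: "N (pCons a f) g = smult a g + N f (Z g)" for a f g
    by (simp add: N_def Z_def ore_mult_pCons)
  \<comment> \<open>This is where the two compatibility hypotheses enter.\<close>
  have d_Y: "map_poly d (Y g) = Z (map_poly d g)" for g
    unfolding Z by (rule poly_eqI)
      (simp add: coeff_map_poly coeff_Y d_add d_\<sigma> d_\<delta> algebra_simps)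
  \<comment> \<open>Substituting \<open>Z\<close> for \<open>y\<close> in \<open>f\<close> and applying the resulting operator is the same as
    left multiplication by the substituted element \<open>N f 1\<close>.\<close>
  have "Z (L g h) = L (Z g) h" for g h
    by (simp add: Z L_Y_left ore_mult_add_left ore_mult_smult_left)
  then have "N f (L g h) = L (N f g) h" for g h
    by (induction f arbitrary: g)
      (simp_all add: N_pCons ore_mult_add_left ore_mult_smult_left, simp add: N_def)
  then have N_L: "N f h = L (N f 1) h" for h
    by (metis L_one_left)
  have "map_poly d (L f g) = L (map_poly d f) g + N f (map_poly d g)"
  proof (induction f arbitrary: g)
    case 0
    then show ?case
      by (simp add: N_def)
  next
    case (pCons a f)
    have "map_poly d (smult a g) = smult (d a) g + smult a (map_poly d g)"
      by (rule poly_eqI) (simp add: coeff_map_poly d_mult)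
    then have "map_poly d (L (pCons a f) g) =
        smult (d a) g + smult a (map_poly d g) + map_poly d (L f (Y g))"
      by (simp add: ore_mult_pCons map_poly_add_hom[OF d_add])
    also have "map_poly d (L f (Y g)) = L (map_poly d f) (Y g) + N f (Z (map_poly d g))"
      by (simp only: pCons.IH d_Y)
    finally show ?case
      by (simp only: map_poly_pCons[of d, OF d0] ore_mult_pCons N_pCons add_ac)
  qed
  then show ?thesis
    by (simp only: N_L[of "map_poly d g"])
qed

locale skew_polynomials_idom = skew_polynomials \<sigma> \<delta> for \<sigma> \<delta> :: "'r::idom \<Rightarrow> 'r"
begin

text \<open>
  The formal derivative in \<open>y\<close>, corrected by \<open>\<tau> = \<sigma>^(-1)\<close> on the coefficients: moving \<open>dy\<close> to the
  left through a coefficient \<open>a\<close> turns it into \<open>\<tau> a\<close>, while \<open>y\<close> commutes with \<open>dy\<close>.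
\<close>

lemma pderiv_twisted:
  fixes \<tau> :: "'r \<Rightarrow> 'r"
  assumes \<tau>\<sigma>: "\<And>a. \<tau> (\<sigma> a) = a" and \<sigma>\<tau>: "\<And>a. \<sigma> (\<tau> a) = a" and \<delta>\<tau>: "\<And>a. \<delta> (\<tau> a) = \<tau> (\<delta> a)"
  defines "D \<equiv> \<lambda>f. pderiv (map_poly \<tau> f)"
  shows "D (L f g) = L (D f) g + L (map_poly \<tau> f) (D g)"
proof -
  have \<tau>_add: "\<tau> (a + b) = \<tau> a + \<tau> b" for a b
    by (metis \<sigma>_add \<sigma>\<tau> \<tau>\<sigma>)
  have \<tau>_mult: "\<tau> (a * b) = \<tau> a * \<tau> b" for a b
    by (metis \<sigma>_mult \<sigma>\<tau> \<tau>\<sigma>)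
  have \<tau>0 [simp]: "\<tau> 0 = 0"
    by (metis \<sigma>_zero \<tau>\<sigma>)
  have D_Y: "D (Y g) = g + Y (D g)" for g
  proof -
    have "map_poly \<tau> (Y g) = pCons 0 g + map_poly \<delta> (map_poly \<tau> g)"
      by (rule poly_eqI) (auto simp: coeff_map_poly coeff_Y coeff_pCons \<tau>_add \<tau>\<sigma> \<delta>\<tau> split: nat.split)
    then have "D (Y g) = g + (pCons 0 (pderiv g) + map_poly \<delta> (D g))"
      by (simp add: D_def pderiv_add pderiv_pCons pderiv_map_poly \<delta>_add)
    also have "pderiv g = map_poly \<sigma> (D g)"
      unfolding D_def pderiv_map_poly[OF \<tau>_add]
      by (rule poly_eqI) (simp add: coeff_map_poly \<sigma>\<tau>)
    finally show ?thesis
      by (simp add: ore_y_def)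
  qed
  show ?thesis
  proof (induction f arbitrary: g)
    case 0
    then show ?case
      by (simp add: D_def)
  next
    case (pCons a f)
    have "map_poly \<tau> (smult a g) = smult (\<tau> a) (map_poly \<tau> g)"
      by (rule poly_eqI) (simp add: coeff_map_poly \<tau>_mult)
    then have "D (smult a g) = smult (\<tau> a) (D g)"
      by (simp add: D_def pderiv_smult)
    moreover have "D (f + g) = D f + D g" for f g
      by (simp add: D_def map_poly_add_hom[OF \<tau>_add] pderiv_add)
    moreover have "D (pCons a f) = map_poly \<tau> f + pCons 0 (D f)"
      by (simp add: D_def map_poly_pCons pderiv_pCons)
    ultimately show ?case
      using pCons.IH by (simp add: ore_mult_pCons map_poly_pCons D_Y ore_mult_add_left L_add_right add_ac)
  qed
qed

end

section \<open>The algebras \<open>A[q,r;p(x)]\<close>\<close>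

lemma sigma_qr_hom:
  "sigma_qr q r (f + g) = sigma_qr q r f + sigma_qr q r g"
  "sigma_qr q r (f - g) = sigma_qr q r f - sigma_qr q r g"
  "sigma_qr q r (f * g) = sigma_qr q r f * sigma_qr q r g"
  "sigma_qr q r (smult t f) = smult t (sigma_qr q r f)"
  "sigma_qr q r 1 = 1" "sigma_qr q r [:t:] = [:t:]" "sigma_qr q r 0 = 0"
  by (simp_all add: sigma_qr_def pcompose_add pcompose_diff pcompose_mult pcompose_smult pcompose_1)

lemma sigma_qr_comp: "sigma_qr q r (sigma_qr q' r' f) = pcompose f [:r' + q' * r, q' * q:]"
  by (simp add: sigma_qr_def pcompose_assoc[symmetric] pcompose_pCons)

lemma pderiv_sigma_qr: "pderiv (sigma_qr q r f) = [:q:] * sigma_qr q r (pderiv f)"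
  by (simp add: sigma_qr_def pderiv_pcompose pderiv_pCons)

lemma delta_p_add: "delta_p q r p (f + g) = delta_p q r p f + delta_p q r p g"
proof -
  have "sigma_qr q r (f + g) - (f + g) = (sigma_qr q r f - f) + (sigma_qr q r g - g)"
    by (simp add: sigma_qr_hom)
  then show ?thesis
    unfolding delta_p_def by (simp only: poly_div_add_left pderiv_add distrib_right if_distrib) simp
qed

lemma delta_p_const: "delta_p q r p [:t:] = 0"
  by (simp add: delta_p_def sigma_qr_hom)

text \<open>
  If \<open>p\<close> is a multiple \<open>\<kappa> (\<sigma> x - x)\<close>, the twisted derivation \<open>f \<mapsto> \<kappa> (\<sigma> f - f)\<close> takes the value
  \<open>p\<close> at \<open>x\<close>, as \<open>\<delta>\<close> does, and twisted derivations of \<open>K[x]\<close> are determined by that value.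
\<close>

lemma delta_p_inner:
  assumes "p = smult \<kappa> [:r, q - 1:]"
  shows "delta_p q r p f = smult \<kappa> (sigma_qr q r f - f)"
proof (induction f)
  case 0
  then show ?case
    by (simp add: delta_p_0 sigma_qr_hom)
next
  case (pCons a f)
  have split: "pCons a f = [:a:] + [:0, 1:] * f"
    by simp
  have x: "sigma_qr q r [:0, 1:] = [:0, 1:] + [:r, q - 1:]"
    by (simp add: sigma_qr_def pcompose_pCons)
  show ?case
    unfolding split delta_p_add delta_p_twisted_leibniz delta_p_const delta_p_x pCons.IH sigma_qr_hom x
    by (simp only: assms) (simp add: algebra_simps smult_diff_right smult_add_right flip: smult_add_left)
qed

interpretation ore: skew_polynomials_idom "sigma_qr q r" "delta_p q r p"
  for q r :: "'k::field" and p :: "'k poly"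
  by unfold_locales (simp_all add: sigma_qr_hom delta_p_add delta_p_twisted_leibniz)

lemma ore_qrp_sel [simp]:
  "alg_carrier (ore_qrp q r p) = UNIV" "alg_scale (ore_qrp q r p) = (\<lambda>t. smult [:t:])"
  "alg_mult (ore_qrp q r p) = ore_mult (sigma_qr q r) (delta_p q r p)" "alg_one (ore_qrp q r p) = 1"
  by (simp_all add: ore_qrp_def)

lemma kalgebra_ore_qrp: "kalgebra (ore_qrp q r p)"
proof -
  interpret vector_space "alg_scale (ore_qrp q r p)"
    by unfold_locales (simp_all add: smult_add_right mult.commute flip: smult_add_left one_pCons)
  show ?thesis
    by unfold_locales
      (simp_all add: ore.L_assoc ore.L_one_left ore.L_one_right ore.L_add_right ore_mult_add_left
        ore_mult_smult_left ore.L_smult_right sigma_qr_hom delta_p_const subspace_UNIV[unfolded ore_qrp_sel])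
qed

lemma affine_ore_qrp: "affine_algebra (ore_qrp q r p)"
proof -
  let ?A = "ore_qrp q r p" and ?S = "{ore_gen_x, ore_gen_y} :: 'a poly poly set"
  have "f \<in> subalgebra ?A hull ?S" for f
  proof (rule subalgebra_hullI)
    fix B assume B: "subalgebra ?A B" "?S \<subseteq> B"
    interpret kalgebra ?A
      by (rule kalgebra_ore_qrp)
    have mult: "ore_mult (sigma_qr q r) (delta_p q r p) g h \<in> B" if "g \<in> B" "h \<in> B" for g h
      using B that by (simp add: subalgebra_def)
    have add: "g + h \<in> B" if "g \<in> B" "h \<in> B" for g h
      using B that subspace_add unfolding subalgebra_def by blast
    have scalar: "[:[:t:]:] \<in> B" for t
      using B subspace_scale[of B 1 t] by (simp add: subalgebra_def)
    have const: "[:a:] \<in> B" for a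
    proof (induction a)
      case 0
      then show ?case
        using scalar[of 0] by simp
    next
      case (pCons t a)
      have "[:pCons t a:] = [:[:t:]:] + ore_mult (sigma_qr q r) (delta_p q r p) ore_gen_x [:a:]"
        by (simp add: ore_mult_const)
      also have "\<dots> \<in> B"
        using B(2) pCons.IH by (intro add mult scalar) auto
      finally show ?case .
    qed
    show "f \<in> B"
    proof (induction f)
      case 0
      then show ?case
        using const[of 0] by simp
    next
      case (pCons a f)
      have "pCons a f = [:a:] + ore_mult (sigma_qr q r) (delta_p q r p) f ore_gen_y"
        using ore.L_pCons_0[of q r p f 1] by (simp add: ore.L_one_right flip: one_pCons)
      also have "\<dots> \<in> B"
        using B(2) pCons.IH by (intro add mult const) auto
      finally show ?case .
    qed
  qed
  then have "subalgebra ?A hull ?S = UNIV"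
    by blast
  then have "generates ?A ?S"
    unfolding generates_def ore_qrp_sel by simp
  then show ?thesis
    unfolding affine_algebra_def by (intro exI[of _ ?S]) simp
qed

section \<open>Gelfand-Kirillov dimension\<close>

text \<open>
  \<open>log\<^sub>m (c m^d) = d + ln c / ln m\<close>, so constant factors do not affect the growth exponent.
\<close>

lemma log_monomial_tendsto:
  assumes "c > (0::real)"
  shows "(\<lambda>m. ereal (log (real m) (c * real m ^ d))) \<longlonglongrightarrow> ereal (real d)"
proof -
  have "filterlim (\<lambda>m. ln (real m)) at_top sequentially"
    by (rule filterlim_compose[OF ln_at_top filterlim_real_sequentially])
  then have "(\<lambda>m. ln c / ln (real m) + real d) \<longlonglongrightarrow> 0 + real d"
    by (intro tendsto_add tendsto_const tendsto_divide_0[OF tendsto_const]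
        filterlim_at_top_imp_at_infinity)
  moreover have "\<forall>\<^sub>F m in sequentially. ln c / ln (real m) + real d = log (real m) (c * real m ^ d)"
    using eventually_ge_at_top[of 2]
  proof eventually_elim
    case (elim m)
    then have "ln (real m) > 0"
      by simp
    then show ?case
      using elim assms by (simp add: log_def ln_mult ln_realpow add_divide_distrib)
  qed
  ultimately show ?thesis
    by (simp add: tendsto_cong)
qed

text \<open>
  Polynomial upper bounds of degree \<open>d\<close> for all generating spaces and a lower bound of degree \<open>d\<close>
  for one of them pin the dimension.
\<close>

lemma gk_dim_eqI:
  fixes A :: "('k::field, 'a::ab_group_add, 'm) kalg_scheme"
  defines "growth \<equiv> \<lambda>S m. real (vector_space.dim (alg_scale A)
    (power_sum A (module.span (alg_scale A) S) m))"
  assumes upper: "\<And>S. \<lbrakk>finite S; S \<subseteq> alg_carrier A\<rbrakk>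
      \<Longrightarrow> \<exists>c>0. \<forall>m\<ge>1. growth S m \<le> c * real m ^ d"
    and S: "finite S" "S \<subseteq> alg_carrier A" and "c > 0"
    and lower: "\<And>m. m \<ge> 1 \<Longrightarrow> c * real m ^ d \<le> growth S m"
  shows "gk_dim A = ereal (real d)"
proof (rule antisym)
  have "limsup (\<lambda>m. ereal (log (real m) (growth T m))) \<le> ereal (real d)"
    if T: "finite T" "T \<subseteq> alg_carrier A" for T
  proof -
    obtain b where "b > 0" and b: "\<And>m. m \<ge> 1 \<Longrightarrow> growth T m \<le> b * real m ^ d"
      using upper[OF T] by blast
    have "\<forall>\<^sub>F m in sequentially.
        ereal (log (real m) (growth T m)) \<le> ereal (log (real m) ((b + 1) * real m ^ d))"
      using eventually_ge_at_top[of 2]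
    proof eventually_elim
      case (elim m)
      have le: "growth T m \<le> (b + 1) * real m ^ d"
        using b[of m] elim by (simp add: distrib_right add_increasing2)
      \<comment> \<open>The constant \<open>b + 1\<close> makes the logarithm of the bound nonnegative, which is needed when
        the growth vanishes: then its logarithm is \<open>0\<close> by convention.\<close>
      have ge: "1 \<le> (b + 1) * real m ^ d"
        using \<open>b > 0\<close> elim mult_mono[of 1 "b + 1" 1 "real m ^ d"] by simp
      show ?case
      proof (cases "growth T m = 0")
        case True
        then have "log (real m) (growth T m) = 0"
          by (simp add: log_def)
        also have "0 \<le> log (real m) ((b + 1) * real m ^ d)"
          using ge elim by (intro zero_le_log_cancel_iff[THEN iffD2]) auto
        finally show ?thesis
          by simp
      next
        case False
        then have "growth T m > 0"
          by (simp add: growth_def)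
        then show ?thesis
          using le elim by simp
      qed
    qed
    then have "limsup (\<lambda>m. ereal (log (real m) (growth T m)))
        \<le> limsup (\<lambda>m. ereal (log (real m) ((b + 1) * real m ^ d)))"
      by (rule Limsup_mono)
    also have "\<dots> = ereal (real d)"
      using \<open>b > 0\<close> by (intro lim_imp_Limsup log_monomial_tendsto) simp_all
    finally show ?thesis .
  qed
  then show "gk_dim A \<le> ereal (real d)"
    unfolding gk_dim_def growth_def by (intro SUP_least) auto
  have "\<forall>\<^sub>F m in sequentially.
      ereal (log (real m) (c * real m ^ d)) \<le> ereal (log (real m) (growth S m))"
    using eventually_ge_at_top[of 2]
  proof eventually_elim
    case (elim m)
    then have "0 < c * real m ^ d"
      using \<open>c > 0\<close> by simp
    with lower[of m] elim show ?case
      by (simp add: less_le_trans)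
  qed
  then have "limsup (\<lambda>m. ereal (log (real m) (c * real m ^ d)))
      \<le> limsup (\<lambda>m. ereal (log (real m) (growth S m)))"
    by (rule Limsup_mono)
  moreover have "limsup (\<lambda>m. ereal (log (real m) (c * real m ^ d))) = ereal (real d)"
    using \<open>c > 0\<close> by (intro lim_imp_Limsup log_monomial_tendsto) simp_all
  ultimately have "ereal (real d) \<le> limsup (\<lambda>m. ereal (log (real m) (growth S m)))"
    by simp
  also have "\<dots> \<le> gk_dim A"
    unfolding gk_dim_def growth_def using S by (intro SUP_upper) auto
  finally show "ereal (real d) \<le> gk_dim A" .
qed

lemma (in vector_space) card_independent_le_dim:
  assumes "independent B" "B \<subseteq> V" "V \<subseteq> span T" "finite T"
  shows "card B \<le> dim V"
proof -
  obtain C where C: "C \<subseteq> V" "independent C" "V \<subseteq> span C" "card C = dim V"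
    by (rule basis_exists)
  then have "finite C"
    using assms independent_span_bound[of T C] by blast
  then show ?thesis
    using assms C independent_span_bound[of C B] by auto
qed

lemma delta_p_degree_le: "degree (delta_p q r p f) \<le> degree f + degree p"
proof (induction f)
  case 0
  then show ?case
    by (simp add: delta_p_0)
next
  case (pCons a f)
  show ?case
  proof (cases "f = 0")
    case True
    then show ?thesis
      by (simp add: delta_p_const)
  next
    case False
    have "pCons a f = [:a:] + [:0, 1:] * f"
      by simp
    then have "delta_p q r p (pCons a f) = p * f + [:r, q:] * delta_p q r p f"
      by (simp only: delta_p_add delta_p_const delta_p_twisted_leibniz delta_p_x)
        (simp add: sigma_qr_def pcompose_pCons)
    moreover have "degree (p * f) \<le> Suc (degree f) + degree p"
      using degree_mult_le[of p f] by simp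
    moreover have "degree ([:r, q:] * delta_p q r p f) \<le> Suc (degree f) + degree p"
      using degree_mult_le[of "[:r, q:]" "delta_p q r p f"] pCons.IH by (simp split: if_splits)
    ultimately show ?thesis
      using False by (simp only: degree_add_le degree_pCons_eq not_False_eq_True)
  qed
qed

context
  fixes q r :: "'k::field" and p :: "'k poly"
begin

text \<open>
  The weight of \<open>y\<close>.  It exceeds \<open>deg p\<close> so that \<open>\<delta>\<close>, which raises degrees by at most \<open>deg p\<close>
  (\<open>delta_p_degree_le\<close>), respects the filtration, and it is positive so that each filtration
  space has finite dimension.
\<close>

definition weight :: nat where "weight = Suc (degree p)"

definition filtration :: "nat \<Rightarrow> 'k poly poly set" where
  "filtration n = {g. \<forall>j. coeff g j = 0 \<or> degree (coeff g j) + weight * j \<le> n}"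

lemma filtration_mono: "m \<le> n \<Longrightarrow> filtration m \<subseteq> filtration n"
  by (force simp: filtration_def)

lemma filtration_0: "0 \<in> filtration n"
  by (simp add: filtration_def)

lemma filtration_add:
  assumes "g \<in> filtration n" "h \<in> filtration n"
  shows "g + h \<in> filtration n"
  unfolding filtration_def mem_Collect_eq
proof
  fix j
  have "coeff g j = 0 \<or> degree (coeff g j) + weight * j \<le> n"
    "coeff h j = 0 \<or> degree (coeff h j) + weight * j \<le> n"
    using assms by (simp_all add: filtration_def)
  then show "coeff (g + h) j = 0 \<or> degree (coeff (g + h) j) + weight * j \<le> n"
    using degree_add_le_max[of "coeff g j" "coeff h j"] by auto
qed

lemma filtration_smult:
  assumes "g \<in> filtration n"
  shows "smult a g \<in> filtration (degree a + n)"
  unfolding filtration_def mem_Collect_eq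
proof
  fix j
  have "coeff g j = 0 \<or> degree (coeff g j) + weight * j \<le> n"
    using assms by (simp add: filtration_def)
  then show "coeff (smult a g) j = 0 \<or> degree (coeff (smult a g) j) + weight * j \<le> degree a + n"
    using degree_mult_le[of a "coeff g j"] by auto
qed

lemma filtration_ore_y:
  assumes "g \<in> filtration n"
  shows "ore_y (sigma_qr q r) (delta_p q r p) g \<in> filtration (n + weight)"
proof -
  have \<sigma>: "degree (sigma_qr q r a) \<le> degree a" for a
    using degree_pcompose_le[of a "[:r, q:]"] by (simp add: sigma_qr_def split: if_splits)
  have P: "coeff g j = 0 \<or> degree (coeff g j) + weight * j \<le> n" for j
    using assms by (simp add: filtration_def)
  have "pCons 0 (map_poly (sigma_qr q r) g) \<in> filtration (n + weight)"
    unfolding filtration_def mem_Collect_eq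
  proof
    fix j
    show "coeff (pCons 0 (map_poly (sigma_qr q r) g)) j = 0 \<or>
        degree (coeff (pCons 0 (map_poly (sigma_qr q r) g)) j) + weight * j \<le> n + weight"
    proof (cases j)
      case (Suc i)
      then show ?thesis
        using P[of i] \<sigma>[of "coeff g i"] by (auto simp: coeff_map_poly sigma_qr_hom)
    qed simp
  qed
  moreover have "map_poly (delta_p q r p) g \<in> filtration (n + weight)"
    unfolding filtration_def mem_Collect_eq
  proof
    fix j
    show "coeff (map_poly (delta_p q r p) g) j = 0 \<or>
        degree (coeff (map_poly (delta_p q r p) g) j) + weight * j \<le> n + weight"
      using P[of j] delta_p_degree_le[of q r p "coeff g j"]
      by (auto simp: coeff_map_poly delta_p_0 weight_def)
  qed
  ultimately show ?thesis
    unfolding ore_y_def by (rule filtration_add)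
qed

lemma filtration_sum: "(\<And>i. i \<in> I \<Longrightarrow> g i \<in> filtration n) \<Longrightarrow> (\<Sum>i\<in>I. g i) \<in> filtration n"
  by (induction I rule: infinite_finite_induct) (auto intro: filtration_add filtration_0)

lemma filtration_mult:
  assumes f: "f \<in> filtration m" and g: "g \<in> filtration n"
  shows "ore_mult (sigma_qr q r) (delta_p q r p) f g \<in> filtration (m + n)"
  unfolding ore_mult_def
proof (rule filtration_sum)
  fix i
  let ?Y = "ore_y (sigma_qr q r) (delta_p q r p)"
  have Y: "(?Y ^^ i) g \<in> filtration (n + weight * i)"
  proof (induction i)
    case (Suc i)
    then show ?case
      using filtration_ore_y[OF Suc] by (simp add: add_ac)
  qed (simp add: g)
  show "smult (coeff f i) ((?Y ^^ i) g) \<in> filtration (m + n)"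
  proof (cases "coeff f i = 0")
    case False
    then have "degree (coeff f i) + (n + weight * i) \<le> m + n"
      using f by (auto simp: filtration_def)
    then show ?thesis
      using filtration_smult[OF Y] filtration_mono by blast
  qed (simp add: filtration_0)
qed

lemma filtration_exhaustive: "\<exists>n. g \<in> filtration n"
proof (induction g)
  case 0
  then show ?case
    using filtration_0 by blast
next
  case (pCons a g)
  then obtain n where n: "g \<in> filtration n"
    by blast
  have "pCons a g \<in> filtration (degree a + n + weight)"
    unfolding filtration_def mem_Collect_eq
  proof
    fix j
    show "coeff (pCons a g) j = 0 \<or>
        degree (coeff (pCons a g) j) + weight * j \<le> degree a + n + weight"
    proof (cases j)
      case (Suc i)
      have "coeff g i = 0 \<or> degree (coeff g i) + weight * i \<le> n"
        using n by (simp add: filtration_def)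
      then show ?thesis
        using Suc by auto
    qed simp
  qed
  then show ?case
    by blast
qed

lemma filtration_exhaustive_finite: "finite S \<Longrightarrow> \<exists>n. S \<subseteq> filtration n"
proof (induction S rule: finite_induct)
  case (insert g S)
  then obtain m n where "S \<subseteq> filtration m" "g \<in> filtration n"
    using filtration_exhaustive by blast
  then have "insert g S \<subseteq> filtration (max m n)"
    using filtration_mono[of m "max m n"] filtration_mono[of n "max m n"] by auto
  then show ?case
    by blast
qed simp

interpretation A: kalgebra "ore_qrp q r p"
  by (rule kalgebra_ore_qrp)

definition monomials :: "nat \<Rightarrow> 'k poly poly set" where
  "monomials n = (\<lambda>(i, j). monom (monom 1 i) j) ` ({..n} \<times> {..n})"

lemma span_subset_filtration: "S \<subseteq> filtration n \<Longrightarrow> A.span S \<subseteq> filtration n"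
proof (rule A.span_minimal)
  show "A.subspace (filtration n)"
    unfolding A.subspace_def
    using filtration_0 filtration_add filtration_smult[of _ n "[:t:]" for t] by auto
qed

lemma power_sum_subset_filtration:
  assumes "S \<subseteq> filtration n"
  shows "power_sum (ore_qrp q r p) (A.span S) m \<subseteq> filtration (n * m)"
  unfolding power_sum_def
proof (rule span_subset_filtration, clarify)
  fix vs assume vs: "set vs \<subseteq> A.span S" "length vs \<le> m"
  have "set vs \<subseteq> filtration n"
    using vs(1) span_subset_filtration[OF assms] by blast
  then have "foldr (alg_mult (ore_qrp q r p)) vs \<one>\<^bsub>ore_qrp q r p\<^esub> \<in> filtration (n * length vs)"
    by (induction vs) (auto simp: filtration_def[of 0] coeff_1 intro: filtration_mult)
  then show "foldr (alg_mult (ore_qrp q r p)) vs \<one>\<^bsub>ore_qrp q r p\<^esub> \<in> filtration (n * m)"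
    using filtration_mono[of "n * length vs" "n * m"] vs(2) by auto
qed

lemma filtration_subset_span_monomials: "filtration n \<subseteq> A.span (monomials n)"
proof
  fix g assume g: "g \<in> filtration n"
  have "monom a j \<in> A.span (monomials n)" if "degree a \<le> n" "j \<le> n" for a j
  proof -
    have sum: "(\<Sum>i\<in>I. monom (b i) j) = monom (\<Sum>i\<in>I. b i) j" for b :: "nat \<Rightarrow> 'k poly" and I
      by (induction I rule: infinite_finite_induct) (simp_all add: add_monom)
    have "(\<Sum>i\<le>n. alg_scale (ore_qrp q r p) (coeff a i) (monom (monom 1 i) j)) \<in> A.span (monomials n)"
      using that by (intro A.span_sum A.span_scale A.span_base) (auto simp: monomials_def)
    also have "(\<Sum>i\<le>n. alg_scale (ore_qrp q r p) (coeff a i) (monom (monom 1 i) j)) = monom a j"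
      using poly_as_sum_of_monoms'[OF that(1)] by (simp add: smult_monom sum)
    finally show ?thesis .
  qed
  moreover have "coeff g j = 0 \<or> degree (coeff g j) \<le> n \<and> j \<le> n" for j
    using g by (auto simp: filtration_def weight_def dest: spec[of _ j])
  ultimately have "monom (coeff g j) j \<in> A.span (monomials n)" for j
    using A.span_zero by (metis monom_0 monom_eq_0)
  then have "(\<Sum>j\<le>degree g. monom (coeff g j) j) \<in> A.span (monomials n)"
    by (intro A.span_sum)
  then show "g \<in> A.span (monomials n)"
    by (simp add: poly_as_sum_of_monoms)
qed

lemma monomials_inj: "inj_on (\<lambda>(i, j). monom (monom (1::'k) i) j) X"
  by (auto simp: inj_on_def monom_eq_iff')

lemma card_monomials: "card (monomials n) = (n + 1) ^ 2"
  by (simp add: monomials_def card_image monomials_inj power2_eq_square)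

lemma independent_monomials: "A.independent (monomials n)"
proof (rule A.independent_if_scalars_zero)
  show "finite (monomials n)"
    by (simp add: monomials_def)
  fix u and v assume sum: "(\<Sum>v\<in>monomials n. alg_scale (ore_qrp q r p) (u v) v) = 0" and "v \<in> monomials n"
  then obtain i j where v: "v = monom (monom 1 i) j" "i \<le> n" "j \<le> n"
    by (auto simp: monomials_def)
  have "0 = coeff (coeff (\<Sum>v\<in>monomials n. alg_scale (ore_qrp q r p) (u v) v) j) i"
    unfolding sum by simp
  also have "\<dots> = (\<Sum>(i', j')\<in>{..n} \<times> {..n}.
      coeff (coeff (smult [:u (monom (monom 1 i') j'):] (monom (monom 1 i') j')) j) i)"
    unfolding monomials_def sum.reindex[OF monomials_inj]
    by (simp add: coeff_sum case_prod_unfold)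
  also have "\<dots> = (\<Sum>x\<in>{..n} \<times> {..n}. if x = (i, j) then u v else 0)"
    by (intro sum.cong) (auto simp: v split: if_splits)
  also have "\<dots> = u v"
    using v by simp
  finally show "u v = 0"
    by simp
qed

text \<open>
  In \<open>x^i y^j\<close> the factors already stand in normal order, so the product of \<open>i\<close> copies of \<open>x\<close> and
  \<open>j\<close> copies of \<open>y\<close> is that monomial for every choice of twisting data.
\<close>

lemma monomials_subset_power_sum:
  "monomials n \<subseteq> power_sum (ore_qrp q r p) (A.span {ore_gen_x, ore_gen_y}) (2 * n)"
proof
  fix v assume "v \<in> monomials n"
  then obtain i j where v: "v = monom (monom 1 i) j" "i \<le> n" "j \<le> n"
    by (auto simp: monomials_def)
  let ?L = "ore_mult (sigma_qr q r) (delta_p q r p)"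
  have "?L ore_gen_y (monom 1 j) = monom 1 (Suc j)" for j
    by (simp add: ore_mult_pCons ore_y_def map_poly_monom delta_p_0 delta_p_1 sigma_qr_hom monom_Suc)
  then have y: "foldr ?L (replicate j ore_gen_y) 1 = monom 1 j"
    by (induction j) simp_all
  have "?L ore_gen_x (monom (monom 1 i) j) = monom (monom 1 (Suc i)) j" for i
    by (simp add: ore_mult_const smult_monom monom_Suc)
  then have "foldr ?L (replicate i ore_gen_x) (monom 1 j) = v"
    unfolding v by (induction i) (simp_all add: one_pCons[symmetric] monom_0)
  with y have "foldr ?L (replicate i ore_gen_x @ replicate j ore_gen_y) 1 = v"
    by simp
  moreover have "set (replicate i ore_gen_x @ replicate j ore_gen_y) \<subseteq> A.span {ore_gen_x, ore_gen_y}"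
    by (rule order_trans[OF _ A.span_superset]) auto
  moreover have "length (replicate i ore_gen_x @ replicate j ore_gen_y) \<le> 2 * n"
    using v by simp
  ultimately show "v \<in> power_sum (ore_qrp q r p) (A.span {ore_gen_x, ore_gen_y}) (2 * n)"
    unfolding power_sum_def by (intro A.span_base) (force simp del: foldr_append)
qed

theorem gk_dim_ore_qrp: "gk_dim (ore_qrp q r p) = ereal (real 2)"
proof (rule gk_dim_eqI)
  show "\<exists>c>0. \<forall>m\<ge>1. real (A.dim (power_sum (ore_qrp q r p) (A.span S) m)) \<le> c * real m ^ 2"
    if "finite S" for S
  proof -
    obtain n where n: "S \<subseteq> filtration n"
      using filtration_exhaustive_finite[OF \<open>finite S\<close>] by blast
    have "real (A.dim (power_sum (ore_qrp q r p) (A.span S) m)) \<le> real (n + 1) ^ 2 * real m ^ 2"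
      if "m \<ge> 1" for m
    proof -
      have "A.dim (power_sum (ore_qrp q r p) (A.span S) m) \<le> card (monomials (n * m))"
        using power_sum_subset_filtration[OF n] filtration_subset_span_monomials
        by (intro A.dim_le_card) (blast, simp add: monomials_def)
      also have "\<dots> = (n * m + 1) ^ 2"
        by (rule card_monomials)
      also have "\<dots> \<le> ((n + 1) * m) ^ 2"
        using that by (intro power_mono) auto
      finally show ?thesis
        by (simp only: flip: of_nat_power of_nat_mult power_mult_distrib)
    qed
    then show ?thesis
      by (intro exI[of _ "real (n + 1) ^ 2"]) simp
  qed
  show "1 / 4 * real m ^ 2 \<le>
      real (A.dim (power_sum (ore_qrp q r p) (A.span {ore_gen_x, ore_gen_y}) m))" for m
  proof -
    let ?V = "power_sum (ore_qrp q r p) (A.span {ore_gen_x, ore_gen_y})"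
    obtain k where "{ore_gen_x, ore_gen_y} \<subseteq> filtration k"
      using filtration_exhaustive_finite[of "{ore_gen_x, ore_gen_y}"] by blast
    then have V: "?V m \<subseteq> A.span (monomials (k * m))"
      by (rule order_trans[OF power_sum_subset_filtration filtration_subset_span_monomials])
    have "?V (2 * (m div 2)) \<subseteq> ?V m"
      unfolding power_sum_def by (intro A.span_mono) auto
    then have "monomials (m div 2) \<subseteq> ?V m"
      using monomials_subset_power_sum[of "m div 2"] by blast
    from A.card_independent_le_dim[OF independent_monomials this V]
    have "(m div 2 + 1) ^ 2 \<le> A.dim (?V m)"
      by (simp add: card_monomials) (simp add: monomials_def)
    then have "real (m div 2 + 1) ^ 2 \<le> real (A.dim (?V m))"
      by (simp only: flip: of_nat_power)
    moreover have "(real m / 2) ^ 2 \<le> real (m div 2 + 1) ^ 2"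
      by (intro power_mono) auto
    ultimately show ?thesis
      by (simp add: power_divide)
  qed
qed simp_all

end

section \<open>Twisted partial derivatives on \<open>A[q,r;p(x)]\<close>\<close>

text \<open>
  The common form of the three cases: \<open>\<sigma>\<close> is the identity, or \<open>p\<close> is a multiple of
  \<open>\<sigma> x - x = (q - 1) x + r\<close>.
\<close>

locale smooth_ore_parameters =
  fixes q r :: "'k::field_char_0" and p :: "'k poly"
  assumes q_nonzero: "q \<noteq> 0"
    and trivial_or_inner: "(q = 1 \<and> r = 0) \<or> (\<exists>\<kappa>. p = smult \<kappa> [:r, q - 1:])"
begin

abbreviation "\<sigma> \<equiv> sigma_qr q r"
abbreviation "\<tau> \<equiv> sigma_qr (1 / q) (- (r / q))"
abbreviation "\<delta> \<equiv> delta_p q r p"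

lemma sigma_tau: "\<sigma> (\<tau> a) = a" and tau_sigma: "\<tau> (\<sigma> a) = a"
  using q_nonzero by (simp_all add: sigma_qr_comp)

lemma delta_cases:
  obtains "\<And>a. \<sigma> a = a" "\<And>a. \<tau> a = a" "\<And>a. \<delta> a = pderiv a * p" "q = 1"
  | \<kappa> where "\<And>a. \<delta> a = smult \<kappa> (\<sigma> a - a)" "pderiv p = [:\<kappa> * (q - 1):]"
proof (cases "q = 1 \<and> r = 0")
  case True
  then show ?thesis
    by (intro that(1)) (simp_all add: sigma_qr_def delta_p_def)
next
  case False
  then obtain \<kappa> where \<kappa>: "p = smult \<kappa> [:r, q - 1:]"
    using trivial_or_inner by blast
  from delta_p_inner[OF \<kappa>] show ?thesis
    by (rule that(2)) (simp add: \<kappa> pderiv_smult pderiv_pCons)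
qed

lemma delta_tau: "\<delta> (\<tau> a) = \<tau> (\<delta> a)"
  by (cases rule: delta_cases) (simp_all add: sigma_qr_hom sigma_tau tau_sigma)

text \<open>
  The compatibility of \<open>d/dx\<close> with the relation \<open>y f = \<sigma> f y + \<delta> f\<close>.  If \<open>\<sigma>\<close> is the identity, this is
  the product rule for \<open>(f' p)'\<close>; if \<open>\<delta> = \<kappa> (\<sigma> - id)\<close>, it is the chain rule
  \<open>(\<sigma> f)' = q \<sigma> (f')\<close> together with \<open>p' = \<kappa> (q - 1)\<close>.
\<close>

lemma pderiv_delta: "pderiv (\<delta> a) = [:q:] * \<delta> (pderiv a) + pderiv p * pderiv a"
proof (cases rule: delta_cases)
  case 1
  then show ?thesis
    by (simp add: pderiv_mult)
next
  case (2 \<kappa>)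
  then show ?thesis
    by (simp add: pderiv_smult pderiv_diff pderiv_sigma_qr smult_diff_right)
      (simp add: algebra_simps flip: smult_add_left)
qed

abbreviation "A \<equiv> ore_qrp q r p"

text \<open>
  \<open>N\<^sub>x\<close> substitutes \<open>q y + p'\<close> for \<open>y\<close>; the twist that belongs to \<open>D\<^sub>y\<close> is \<open>map_poly \<tau>\<close>.
\<close>

definition "D\<^sub>x f = map_poly pderiv f"
definition "N\<^sub>x f = ore_mult (\<lambda>a. [:q:] * \<sigma> a) (\<lambda>a. [:q:] * \<delta> a + pderiv p * a) f 1"
definition "D\<^sub>y f = pderiv (map_poly \<tau> f)"

text \<open>
  \<open>(q y + p')^i\<close> has leading term \<open>q^i y^i\<close>, so \<open>N\<^sub>x\<close> is triangular with units on the diagonal.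
\<close>

lemma bij_N\<^sub>x: "bij N\<^sub>x"
proof -
  define Z where "Z = ore_y (\<lambda>a. [:q:] * \<sigma> a) (\<lambda>a. [:q:] * \<delta> a + pderiv p * a)"
  have coeff_Z: "coeff (Z g) n = (if n = 0 then 0 else [:q:] * \<sigma> (coeff g (n - 1)))
      + ([:q:] * \<delta> (coeff g n) + pderiv p * coeff g n)" for g n
    unfolding Z_def by (subst coeff_ore_y) simp_all
  have deg: "degree ((Z ^^ i) 1) \<le> i" for i
  proof (induction i)
    case (Suc i)
    then show ?case
      by (intro degree_le) (auto simp: coeff_Z coeff_eq_0)
  qed simp
  have "coeff ((Z ^^ i) 1) i = [:q ^ i:]" for i
    by (induction i) (use deg in \<open>simp_all add: coeff_Z coeff_eq_0 le_imp_less_Suc sigma_qr_hom one_pCons\<close>)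
  then have "coeff ((Z ^^ i) 1) i dvd 1" for i
    using q_nonzero by (simp add: is_unit_const_poly_iff dvd_field_iff)
  then show ?thesis
    by (rule triangular_bij[of "\<lambda>i. (Z ^^ i) 1", OF deg]) (simp only: N\<^sub>x_def Z_def ore_mult_eq_sum)
qed

lemma bij_map_tau: "bij (map_poly \<tau>)"
proof (rule o_bij)
  show "map_poly \<sigma> \<circ> map_poly \<tau> = id" "map_poly \<tau> \<circ> map_poly \<sigma> = id"
    by (auto simp: fun_eq_iff poly_eq_iff coeff_map_poly sigma_qr_hom sigma_tau tau_sigma)
qed

lemma skew_derivation_x: "skew_derivation A D\<^sub>x N\<^sub>x ore_gen_x"
proof (intro skew_derivation.intro skew_derivation_axioms.intro kalgebra_ore_qrp bij_N\<^sub>x)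
  show "D\<^sub>x (f \<otimes>\<^bsub>A\<^esub> g) = D\<^sub>x f \<otimes>\<^bsub>A\<^esub> g + N\<^sub>x f \<otimes>\<^bsub>A\<^esub> D\<^sub>x g" for f g
    unfolding D\<^sub>x_def N\<^sub>x_def ore_qrp_sel
    by (rule ore.map_poly_derivation)
      (simp_all only: pderiv_add pderiv_mult pderiv_sigma_qr pderiv_delta mult.commute add.commute)
qed (simp_all add: D\<^sub>x_def map_poly_add_hom[OF pderiv_add] poly_eq_iff coeff_map_poly pderiv_smult
    map_poly_pCons pderiv_pCons one_pCons)

lemma skew_derivation_y: "skew_derivation A D\<^sub>y (map_poly \<tau>) ore_gen_y"
proof (intro skew_derivation.intro skew_derivation_axioms.intro kalgebra_ore_qrp bij_map_tau)
  show "D\<^sub>y (f \<otimes>\<^bsub>A\<^esub> g) = D\<^sub>y f \<otimes>\<^bsub>A\<^esub> g + map_poly \<tau> f \<otimes>\<^bsub>A\<^esub> D\<^sub>y g" for f g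
    unfolding D\<^sub>y_def ore_qrp_sel
    by (rule ore.pderiv_twisted) (simp_all add: sigma_tau tau_sigma delta_tau)
  show "D\<^sub>y (alg_scale A t f) = alg_scale A t (D\<^sub>y f)" for t f
  proof -
    have "map_poly \<tau> (smult [:t:] f) = smult [:t:] (map_poly \<tau> f)"
      by (simp add: poly_eq_iff coeff_map_poly sigma_qr_hom)
    then show ?thesis
      by (simp add: D\<^sub>y_def pderiv_smult)
  qed
qed (simp_all add: D\<^sub>y_def map_poly_add_hom[OF sigma_qr_hom(1)] pderiv_add map_poly_pCons
    sigma_qr_hom pderiv_pCons one_pCons)

text \<open>
  \<open>\<tau> (f') = q (\<tau> f)'\<close> is the chain rule for \<open>\<tau>\<close> and gives \<open>D\<^sub>y D\<^sub>x = q D\<^sub>x D\<^sub>y\<close>.  In characteristic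
  zero, \<open>D\<^sub>y f = 0\<close> leaves only a coefficient \<open>f \<in> K[x]\<close>, and then \<open>D\<^sub>x f = f' = 0\<close> makes it a scalar.
\<close>

lemma skew_partials: "skew_partials A D\<^sub>x N\<^sub>x ore_gen_x D\<^sub>y (map_poly \<tau>) ore_gen_y q"
proof (intro skew_partials.intro skew_partials_axioms.intro skew_derivation_x skew_derivation_y q_nonzero)
  show "D\<^sub>y (D\<^sub>x f) = alg_scale A q (D\<^sub>x (D\<^sub>y f))" for f
  proof -
    have "\<tau> (pderiv a) = [:q:] * pderiv (\<tau> a)" for a
      using q_nonzero by (simp add: pderiv_sigma_qr)
    then have "map_poly \<tau> (map_poly pderiv f) = smult [:q:] (map_poly pderiv (map_poly \<tau> f))"
      by (simp add: poly_eq_iff coeff_map_poly sigma_qr_hom)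
    then show ?thesis
      by (simp add: D\<^sub>x_def D\<^sub>y_def pderiv_smult pderiv_map_poly[OF pderiv_add])
  qed
  show "f \<in> range (\<lambda>t. alg_scale A t \<one>\<^bsub>A\<^esub>)" if "D\<^sub>x f = 0" "D\<^sub>y f = 0" for f
  proof -
    have "degree (map_poly \<tau> f) = 0"
      using that(2) by (simp add: D\<^sub>y_def pderiv_eq_0_iff)
    then obtain a where "map_poly \<tau> f = [:a:]"
      by (rule degree_eq_zeroE)
    then have "map_poly \<tau> f = map_poly \<tau> [:\<sigma> a:]"
      by (simp add: map_poly_pCons sigma_qr_hom tau_sigma)
    then have f: "f = [:\<sigma> a:]"
      using bij_map_tau by (simp add: bij_def inj_eq)
    then have "pderiv (\<sigma> a) = 0"
      using that(1) by (simp add: D\<^sub>x_def map_poly_pCons)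
    then obtain t where "\<sigma> a = [:t:]"
      unfolding pderiv_eq_0_iff by (rule degree_eq_zeroE)
    then show ?thesis
      using f by auto
  qed
qed (simp_all add: D\<^sub>x_def D\<^sub>y_def map_poly_pCons sigma_qr_hom pderiv_pCons)

end

text \<open>
  The second and third alternatives are both instances of \<open>p = \<kappa> ((q - 1) x + r)\<close>, with
  \<open>\<kappa> = c / r\<close> and \<open>\<kappa> = c / (q - 1)\<close> respectively.
\<close>

theorem proposition3p3:
  fixes q r :: "'k::{alg_closed_field, field_char_0}" and p :: "'k poly"
  assumes "q \<noteq> 0"
    and "(q = 1 \<and> r = 0)
       \<or> (q = 1 \<and> r \<noteq> 0 \<and> (\<exists>c. p = [:c:]))
       \<or> (q \<noteq> 1 \<and> (\<exists>c. p = smult c ([:0, 1:] + [:r / (q - 1):])))"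
  shows "differentially_smooth (ore_qrp q r p)"
proof -
  have "p = smult (c / r) [:r, q - 1:]" if "q = 1" "r \<noteq> 0" "p = [:c:]" for c
    using that by simp
  moreover have "p = smult (c / (q - 1)) [:r, q - 1:]"
    if "q \<noteq> 1" "p = smult c ([:0, 1:] + [:r / (q - 1):])" for c
    using that by simp
  ultimately have "(q = 1 \<and> r = 0) \<or> (\<exists>\<kappa>. p = smult \<kappa> [:r, q - 1:])"
    using assms(2) by metis
  with \<open>q \<noteq> 0\<close> interpret smooth_ore_parameters q r p
    by unfold_locales
  from skew_partials interpret partials: skew_partials A D\<^sub>x N\<^sub>x ore_gen_x D\<^sub>y "map_poly \<tau>" ore_gen_y q .
  show ?thesis
    unfolding differentially_smooth_def
    using kalgebra_ore_qrp affine_ore_qrp gk_dim_ore_qrp partials.integrable_calculus by blast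
qed

end
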